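(* Let $M$ be a countable transitive model of $\mathrm{ZFC}'$, let $P\in M$ be a perfect-tree forcing, let $\langle\Phi^j:j<\omega\rangle$ be a $\sqsubseteq$-increasing sequence in $\mathrm{spg}(P)$ generic over $M$, and let $\mathbb U$ be the associated set of trees. Suppose that $c=\langle C^i_m:m<\omega,\ i<2\rangle\in M$ is a $P^{<\omega}$-real name and that for every $k<\omega$ the set $D(k)=\{\tau\in P^{<\omega}:\tau\text{ directly forces }c\neq\pi_k\}$ is dense in $P^{<\omega}$. Let $u\in(P\cup\mathbb U)^{<\omega}$ and $U\in\mathbb U$. Then there is a condition $v\in(P\cup\mathbb U)^{<\omega}$, all of whose components different from $2^{<\omega}$ belong to $\mathbb U$, such that $v\le u$ and $v$ directly forces $c\notin[U]$.
   Context: $2^{<\omega}$ is the set of finite binary strings; $s\subseteq t$ means $t$ extends $s$; $\mathrm{lh}(s)$ is the length; $2^n$ the strings of length $n$. A tree is a subset of $2^{<\omega}$ closed under initial segments; $T\restriction s=\{t\in T:s\subseteq t\lor t\subseteq s\}$. $\mathbf{PT}$ is the set of non-empty perfect trees; $\mathrm{stem}(T)$ is the largest $s\in T$ with $T=T\restriction s$; $[T]=\{a\in 2^\omega:\forall n\,(a\restriction n\in T)\}$. A perfect-tree forcing is $P\subseteq\mathbf{PT}$ with $2^{<\omega}\in P$ and $T\restriction u\in P$ whenever $u\in T\in P$. For a set $Q$ of trees containing $2^{<\omega}$, $Q^{<\omega}$ is the set of sequences $\langle T_n:n<\omega\rangle$ with $T_n\in Q$ and $T_n=2^{<\omega}$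 for all but finitely many $n$, ordered componentwise by inclusion (smaller = stronger). $\mathrm{ZFC}'$ is ZFC without power set plus "$\mathcal P(\omega)$ exists". $\mathrm{spe}(P)$: finite systems $\varphi=\langle T_s:s\in 2^{<n}\rangle$, $n=\mathrm{ht}(\varphi)$, with $T_s\in P$, $T_{s^\frown i}\subseteq T_s$ and $\mathrm{stem}(T_s)^\frown i\subseteq\mathrm{stem}(T_{s^\frown i})$ whenever $s^\frown i\in 2^{<n}$; $\psi\sqsubseteq\varphi$ iff $\mathrm{ht}(\psi)\le\mathrm{ht}(\varphi)$ and they agree on $2^{<\mathrm{ht}(\psi)}$. $\mathrm{spg}(P)$: sequences $\Phi=\langle\varphi_k:k<\omega\rangle$ in $\mathrm{spe}(P)$ with all but finitely many $\varphi_k$ empty, ordered componentwise by $\sqsubseteq$. A $\sqsubseteq$-increasing sequence $\langle\Phi^j\rangle$, $\Phi^j=\langle\varphi^j_k:k<\omega\rangle$, is generic over $M$ if it meets every $D\in M$, $D\subseteq\mathrm{spg}(P)$, dense in $(\mathrm{spg}(P),\sqsubseteq)$. Then there are trees $T^k_s\in P$ with $\varphi^j_k=\langle T^k_s:s\in 2^{<\mathrm{ht}(\varphi^j_k)}\rangle$, and $U^k_s=\bigcap_{n\ge\mathrm{lh}(s)}\bigcup_{t\in 2^n,\,s\subseteq t}T^k_t$; $\mathbb U=\{U^k_s:k<\omega,s\in 2^{<\omega}\}$. Names and direct forcing. A $P^{<\omega}$-real name is a system $c=\langle C^i_n:n<\omega,i<2\rangle$ of sets $C^i_n\subseteq P^{<\omega}$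 such that each $C^0_n\cup C^1_n$ is pre-dense in $P^{<\omega}$ and every element of $C^0_n$ is incompatible in $P^{<\omega}$ with every element of $C^1_n$. For $k<\omega$, $\pi_k$ is the name with $C^i_n=\{\rho^i_{nk}\}$, where $\rho^i_{nk}(k)=\{s\in 2^{<\omega}:\mathrm{lh}(s)>n\Rightarrow s(n)=i\}$ and $\rho^i_{nk}(m)=2^{<\omega}$ for $m\ne k$ (a name for the $k$-th generic real). For $\tau\in\mathbf{PT}^{<\omega}$: $\tau$ directly forces $c(n)=i$ iff $\tau\le\sigma$ for some $\sigma\in C^i_n$; $\tau$ directly forces $s\subset c$ (for $s\in 2^{<\omega}$) iff $\tau$ directly forces $c(n)=s(n)$ for all $n<\mathrm{lh}(s)$; $\tau$ directly forces $d\neq c$ iff there are incomparable $s,t\in 2^{<\omega}$ with $\tau$ directly forcing $s\subset c$ and $t\subset d$; $\tau$ directly forces $c\notin[T]$ iff there is $s\in 2^{<\omega}\setminus T$ with $\tau$ directly forcing $s\subset c$. *)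

theory Defs
  imports "HOL-Library.Countable_Set_Type" "HOL-Library.Sublist"
begin

section \<open>Countable transitive models of ZFC'\<close>

text \<open>
  The type \<open>hc\<close> is the universe of hereditarily countable sets. Every element of a countable
  transitive set is hereditarily countable, so the countable transitive sets of the ambient
  set theory are exactly the countable transitive \<open>M :: hc set\<close>.
\<close>

datatype hc = HC (unHC: "hc cset")

definition elts :: "hc \<Rightarrow> hc set" where
  "elts x = rcset (unHC x)"

text \<open>The set with the given elements; only meaningful for countable \<open>A\<close>.\<close>

definition hset :: "hc set \<Rightarrow> hc" where
  "hset A = HC (acset A)"

lemma elts_hset [simp]: "countable A \<Longrightarrow> elts (hset A) = A"
  by (simp add: elts_def hset_def)

lemma countable_elts [simp]: "countable (elts x)"
  by (simp add: elts_def)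

lemma elts_inject: "elts x = elts y \<longleftrightarrow> x = y"
  by (metis elts_def hc.expand rcset_inject)

lemma wf_elts: "wf {(x, y). x \<in> elts y}"
proof -
  have "\<forall>P. (\<forall>x. (\<forall>y. (y, x) \<in> {(x, y). x \<in> elts y} \<longrightarrow> P y) \<longrightarrow> P x) \<longrightarrow> (\<forall>x. P x)"
  proof (intro allI impI)
    fix P :: "hc \<Rightarrow> bool" and x
    assume step: "\<forall>x. (\<forall>y. (y, x) \<in> {(x, y). x \<in> elts y} \<longrightarrow> P y) \<longrightarrow> P x"
    show "P x"
    proof (induction x)
      case (HC X)
      then show ?case
        using step by (auto simp: elts_def cin.rep_eq)
    qed
  qed
  then show ?thesis unfolding wf_def .
qed

text \<open>First-order formulas of set theory with named variables.\<close>

datatype fm = Mem nat nat | Eql nat nat | Neg fm | Conj fm fm | All nat fm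

primrec sat :: "hc set \<Rightarrow> (nat \<Rightarrow> hc) \<Rightarrow> fm \<Rightarrow> bool" where
  "sat M e (Mem m n) \<longleftrightarrow> e m \<in> elts (e n)"
| "sat M e (Eql m n) \<longleftrightarrow> e m = e n"
| "sat M e (Neg \<phi>) \<longleftrightarrow> \<not> sat M e \<phi>"
| "sat M e (Conj \<phi> \<psi>) \<longleftrightarrow> sat M e \<phi> \<and> sat M e \<psi>"
| "sat M e (All n \<phi>) \<longleftrightarrow> (\<forall>x\<in>M. sat M (e(n := x)) \<phi>)"

definition transitive_set :: "hc set \<Rightarrow> bool" where
  "transitive_set M \<longleftrightarrow> (\<forall>x\<in>M. elts x \<subseteq> M)"

text \<open>
  The axioms below are relativized to \<open>M\<close>: each one is written out as the satisfaction of the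
  corresponding sentence in the structure \<open>(M, \<in>)\<close>.
\<close>

definition ax_extensionality :: "hc set \<Rightarrow> bool" where
  "ax_extensionality M \<longleftrightarrow>
     (\<forall>x\<in>M. \<forall>y\<in>M. (\<forall>z\<in>M. z \<in> elts x \<longleftrightarrow> z \<in> elts y) \<longrightarrow> x = y)"

definition ax_foundation :: "hc set \<Rightarrow> bool" where
  "ax_foundation M \<longleftrightarrow>
     (\<forall>x\<in>M. (\<exists>y\<in>M. y \<in> elts x) \<longrightarrow>
        (\<exists>y\<in>M. y \<in> elts x \<and> \<not> (\<exists>z\<in>M. z \<in> elts x \<and> z \<in> elts y)))"

definition ax_pairing :: "hc set \<Rightarrow> bool" where
  "ax_pairing M \<longleftrightarrow>
     (\<forall>x\<in>M. \<forall>y\<in>M. \<exists>z\<in>M. \<forall>w\<in>M. w \<in> elts z \<longleftrightarrow> w = x \<or> w = y)"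

definition ax_union :: "hc set \<Rightarrow> bool" where
  "ax_union M \<longleftrightarrow>
     (\<forall>x\<in>M. \<exists>u\<in>M. \<forall>w\<in>M. w \<in> elts u \<longleftrightarrow> (\<exists>y\<in>M. y \<in> elts x \<and> w \<in> elts y))"

definition inductive_in :: "hc set \<Rightarrow> hc \<Rightarrow> bool" where
  "inductive_in M x \<longleftrightarrow>
     (\<exists>z\<in>M. z \<in> elts x \<and> (\<forall>w\<in>M. w \<notin> elts z)) \<and>
     (\<forall>y\<in>M. y \<in> elts x \<longrightarrow>
        (\<exists>z\<in>M. z \<in> elts x \<and> (\<forall>w\<in>M. w \<in> elts z \<longleftrightarrow> w \<in> elts y \<or> w = y)))"

definition ax_infinity :: "hc set \<Rightarrow> bool" where
  "ax_infinity M \<longleftrightarrow> (\<exists>x\<in>M. inductive_in M x)"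

definition omega_in :: "hc set \<Rightarrow> hc \<Rightarrow> bool" where
  "omega_in M x \<longleftrightarrow> inductive_in M x \<and>
     (\<forall>y\<in>M. inductive_in M y \<longrightarrow> (\<forall>z\<in>M. z \<in> elts x \<longrightarrow> z \<in> elts y))"

definition ax_power_omega :: "hc set \<Rightarrow> bool" where
  "ax_power_omega M \<longleftrightarrow>
     (\<exists>w\<in>M. omega_in M w \<and>
        (\<exists>p\<in>M. \<forall>x\<in>M. x \<in> elts p \<longleftrightarrow> (\<forall>y\<in>M. y \<in> elts x \<longrightarrow> y \<in> elts w)))"

text \<open>
  In the two schemes the variables \<open>0\<close> and \<open>1\<close> are the arguments and all other
  variables are parameters, whose values are given by the assignment \<open>e\<close>.
\<close>

definition ax_separation :: "hc set \<Rightarrow> bool" where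
  "ax_separation M \<longleftrightarrow>
     (\<forall>\<phi> e. range e \<subseteq> M \<longrightarrow>
        (\<forall>a\<in>M. \<exists>b\<in>M. \<forall>x\<in>M. x \<in> elts b \<longleftrightarrow> x \<in> elts a \<and> sat M (e(0 := x)) \<phi>))"

definition ax_replacement :: "hc set \<Rightarrow> bool" where
  "ax_replacement M \<longleftrightarrow>
     (\<forall>\<phi> e. range e \<subseteq> M \<longrightarrow>
        (\<forall>a\<in>M.
          (\<forall>x\<in>M. x \<in> elts a \<longrightarrow>
             (\<forall>y\<in>M. \<forall>z\<in>M. sat M (e(0 := x, 1 := y)) \<phi> \<and> sat M (e(0 := x, 1 := z)) \<phi> \<longrightarrow> y = z))
          \<longrightarrow> (\<exists>b\<in>M. \<forall>y\<in>M. y \<in> elts b \<longleftrightarrow>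
                 (\<exists>x\<in>M. x \<in> elts a \<and> sat M (e(0 := x, 1 := y)) \<phi>))))"

definition ax_choice :: "hc set \<Rightarrow> bool" where
  "ax_choice M \<longleftrightarrow>
     (\<forall>a\<in>M.
        (\<forall>x\<in>M. x \<in> elts a \<longrightarrow> (\<exists>y\<in>M. y \<in> elts x)) \<and>
        (\<forall>x\<in>M. \<forall>y\<in>M. x \<in> elts a \<and> y \<in> elts a \<and> x \<noteq> y \<longrightarrow>
            \<not> (\<exists>z\<in>M. z \<in> elts x \<and> z \<in> elts y))
        \<longrightarrow> (\<exists>c\<in>M. \<forall>x\<in>M. x \<in> elts a \<longrightarrow> (\<exists>!y. y \<in> M \<and> y \<in> elts x \<and> y \<in> elts c)))"

text \<open>ZFC without the power set axiom, plus the existence of the power set of \<open>\<omega>\<close>.\<close>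

definition models_ZFC' :: "hc set \<Rightarrow> bool" where
  "models_ZFC' M \<longleftrightarrow>
     ax_extensionality M \<and> ax_foundation M \<and> ax_pairing M \<and> ax_union M \<and> ax_infinity M \<and>
     ax_separation M \<and> ax_replacement M \<and> ax_choice M \<and> ax_power_omega M"

definition ctm_ZFC' :: "hc set \<Rightarrow> bool" where
  "ctm_ZFC' M \<longleftrightarrow> countable M \<and> transitive_set M \<and> models_ZFC' M"


section \<open>Trees and perfect-tree forcings\<close>

text \<open>Finite binary strings are \<open>bool list\<close>, with \<open>False\<close> for 0 and \<open>True\<close> for 1; the tree
  of all strings is \<open>UNIV\<close>.\<close>

type_synonym str = "bool list"
type_synonym tree = "str set"

definition is_tree :: "tree \<Rightarrow> bool" where
  "is_tree T \<longleftrightarrow> (\<forall>t\<in>T. \<forall>s. prefix s t \<longrightarrow> s \<in> T)"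

definition PT :: "tree set" where
  "PT = {T. is_tree T \<and> T \<noteq> {} \<and>
            (\<forall>s\<in>T. \<exists>t. prefix s t \<and> t @ [False] \<in> T \<and> t @ [True] \<in> T)}"

definition restr :: "tree \<Rightarrow> str \<Rightarrow> tree" where
  "restr T s = {t \<in> T. prefix s t \<or> prefix t s}"

definition stem :: "tree \<Rightarrow> str" where
  "stem T = (THE s. s \<in> T \<and> T = restr T s \<and> (\<forall>r\<in>T. T = restr T r \<longrightarrow> prefix r s))"

definition perfect_tree_forcing :: "tree set \<Rightarrow> bool" where
  "perfect_tree_forcing P \<longleftrightarrow> P \<subseteq> PT \<and> UNIV \<in> P \<and> (\<forall>T\<in>P. \<forall>u\<in>T. restr T u \<in> P)"

text \<open>
  The finite support product. The componentwise ordering by inclusion is the ordering \<open>\<le>\<close>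
  of the function type.
\<close>

type_synonym cond = "nat \<Rightarrow> tree"

definition finsupp :: "tree set \<Rightarrow> cond set" where
  "finsupp Q = {\<tau>. range \<tau> \<subseteq> Q \<and> finite {n. \<tau> n \<noteq> UNIV}}"

definition compat_in :: "cond set \<Rightarrow> cond \<Rightarrow> cond \<Rightarrow> bool" where
  "compat_in X \<sigma> \<tau> \<longleftrightarrow> (\<exists>\<rho>\<in>X. \<rho> \<le> \<sigma> \<and> \<rho> \<le> \<tau>)"

definition dense_in :: "cond set \<Rightarrow> cond set \<Rightarrow> bool" where
  "dense_in X D \<longleftrightarrow> D \<subseteq> X \<and> (\<forall>\<tau>\<in>X. \<exists>\<sigma>\<in>D. \<sigma> \<le> \<tau>)"

definition predense_in :: "cond set \<Rightarrow> cond set \<Rightarrow> bool" where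
  "predense_in X D \<longleftrightarrow> D \<subseteq> X \<and> (\<forall>\<tau>\<in>X. \<exists>\<sigma>\<in>D. compat_in X \<sigma> \<tau>)"


section \<open>Names and direct forcing\<close>

text \<open>\<open>c n i\<close> is the set $C^i_n$.\<close>

type_synonym real_sys = "nat \<Rightarrow> bool \<Rightarrow> cond set"

definition real_name :: "tree set \<Rightarrow> real_sys \<Rightarrow> bool" where
  "real_name P c \<longleftrightarrow>
     (\<forall>n i. c n i \<subseteq> finsupp P) \<and>
     (\<forall>n. predense_in (finsupp P) (c n False \<union> c n True)) \<and>
     (\<forall>n. \<forall>\<sigma>\<in>c n False. \<forall>\<tau>\<in>c n True. \<not> compat_in (finsupp P) \<sigma> \<tau>)"

definition pi_name :: "nat \<Rightarrow> real_sys" where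
  "pi_name k n i = {(\<lambda>m. if m = k then {s. n < length s \<longrightarrow> s ! n = i} else UNIV)}"

definition forces_value :: "cond \<Rightarrow> real_sys \<Rightarrow> nat \<Rightarrow> bool \<Rightarrow> bool" where
  "forces_value \<tau> c n i \<longleftrightarrow> (\<exists>\<sigma>\<in>c n i. \<tau> \<le> \<sigma>)"

definition forces_initial :: "cond \<Rightarrow> str \<Rightarrow> real_sys \<Rightarrow> bool" where
  "forces_initial \<tau> s c \<longleftrightarrow> (\<forall>n<length s. forces_value \<tau> c n (s ! n))"

definition forces_neq :: "cond \<Rightarrow> real_sys \<Rightarrow> real_sys \<Rightarrow> bool" where
  "forces_neq \<tau> d c \<longleftrightarrow> (\<exists>s t. s \<parallel> t \<and> forces_initial \<tau> s c \<and> forces_initial \<tau> t d)"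

definition forces_notin_branches :: "cond \<Rightarrow> real_sys \<Rightarrow> tree \<Rightarrow> bool" where
  "forces_notin_branches \<tau> c T \<longleftrightarrow> (\<exists>s. s \<notin> T \<and> forces_initial \<tau> s c)"


section \<open>Splitting systems\<close>

text \<open>A finite system indexed by the strings of length \<open>< n\<close> is a partial map with that domain.\<close>

type_synonym tsys = "str \<rightharpoonup> tree"
type_synonym gsys = "nat \<Rightarrow> tsys"

definition spe :: "tree set \<Rightarrow> tsys set" where
  "spe P = {\<phi>. (\<exists>n. dom \<phi> = {s. length s < n}) \<and> ran \<phi> \<subseteq> P \<and>
     (\<forall>s i T T'. \<phi> s = Some T \<and> \<phi> (s @ [i]) = Some T' \<longrightarrow>
        T' \<subseteq> T \<and> prefix (stem T @ [i]) (stem T'))}"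

definition ht :: "tsys \<Rightarrow> nat" where
  "ht \<phi> = (THE n. dom \<phi> = {s. length s < n})"

definition spe_le :: "tsys \<Rightarrow> tsys \<Rightarrow> bool" where
  "spe_le \<psi> \<phi> \<longleftrightarrow> ht \<psi> \<le> ht \<phi> \<and> (\<forall>s. length s < ht \<psi> \<longrightarrow> \<psi> s = \<phi> s)"

definition spg :: "tree set \<Rightarrow> gsys set" where
  "spg P = {\<Phi>. range \<Phi> \<subseteq> spe P \<and> finite {k. \<Phi> k \<noteq> Map.empty}}"

definition spg_le :: "gsys \<Rightarrow> gsys \<Rightarrow> bool" where
  "spg_le \<Psi> \<Phi> \<longleftrightarrow> (\<forall>k. spe_le (\<Psi> k) (\<Phi> k))"

text \<open>In this ordering the larger systems are the stronger ones.\<close>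

definition spg_dense :: "tree set \<Rightarrow> gsys set \<Rightarrow> bool" where
  "spg_dense P D \<longleftrightarrow> D \<subseteq> spg P \<and> (\<forall>\<Psi>\<in>spg P. \<exists>\<Phi>\<in>D. spg_le \<Psi> \<Phi>)"


section \<open>Membership in a model\<close>

text \<open>
  The objects above are translated into \<open>hc\<close> in the usual set-theoretic way: naturals as von
  Neumann ordinals, ordered pairs as Kuratowski pairs, functions and sequences (in particular
  strings, as functions from their length to 2) as sets of pairs.
\<close>

definition hpair :: "hc \<Rightarrow> hc \<Rightarrow> hc" where
  "hpair x y = hset {hset {x}, hset {x, y}}"

primrec hnat :: "nat \<Rightarrow> hc" where
  "hnat 0 = hset {}"
| "hnat (Suc n) = hset (insert (hnat n) (elts (hnat n)))"

definition hbit :: "bool \<Rightarrow> hc" where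
  "hbit i = hnat (of_bool i)"

definition hstr :: "str \<Rightarrow> hc" where
  "hstr s = hset {hpair (hnat n) (hbit (s ! n)) | n. n < length s}"

definition htree :: "tree \<Rightarrow> hc" where
  "htree T = hset (hstr ` T)"

definition hcond :: "cond \<Rightarrow> hc" where
  "hcond \<tau> = hset {hpair (hnat n) (htree (\<tau> n)) | n. True}"

definition htsys :: "tsys \<Rightarrow> hc" where
  "htsys \<phi> = hset {hpair (hstr s) (htree T) | s T. \<phi> s = Some T}"

definition hgsys :: "gsys \<Rightarrow> hc" where
  "hgsys \<Phi> = hset {hpair (hnat k) (htsys (\<Phi> k)) | k. True}"

text \<open>
  The set \<open>A\<close> is an element of \<open>M\<close>. The countability, automatic for elements of a countable
  transitive set, makes \<open>hset A\<close> meaningful.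
\<close>

definition set_in :: "hc set \<Rightarrow> hc set \<Rightarrow> bool" where
  "set_in A M \<longleftrightarrow> countable A \<and> hset A \<in> M"

definition forcing_in :: "tree set \<Rightarrow> hc set \<Rightarrow> bool" where
  "forcing_in P M \<longleftrightarrow> set_in (htree ` P) M"

definition gsys_set_in :: "gsys set \<Rightarrow> hc set \<Rightarrow> bool" where
  "gsys_set_in D M \<longleftrightarrow> set_in (hgsys ` D) M"

definition real_sys_in :: "real_sys \<Rightarrow> hc set \<Rightarrow> bool" where
  "real_sys_in c M \<longleftrightarrow> (\<forall>n i. countable (c n i)) \<and>
     set_in {hpair (hpair (hnat n) (hbit i)) (hset (hcond ` c n i)) | n i. True} M"


section \<open>Generic sequences and the associated trees\<close>

definition increasing_seq :: "tree set \<Rightarrow> (nat \<Rightarrow> gsys) \<Rightarrow> bool" where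
  "increasing_seq P \<Phi> \<longleftrightarrow> range \<Phi> \<subseteq> spg P \<and> (\<forall>j. spg_le (\<Phi> j) (\<Phi> (Suc j)))"

definition generic_over :: "hc set \<Rightarrow> tree set \<Rightarrow> (nat \<Rightarrow> gsys) \<Rightarrow> bool" where
  "generic_over M P \<Phi> \<longleftrightarrow> (\<forall>D. gsys_set_in D M \<and> spg_dense P D \<longrightarrow> (\<exists>j. \<Phi> j \<in> D))"

text \<open>
  The tree $T^k_s$. For an increasing generic sequence the systems at \<open>k\<close> agree and their
  heights are unbounded, so exactly one tree satisfies the description.
\<close>

definition lim_tree :: "(nat \<Rightarrow> gsys) \<Rightarrow> nat \<Rightarrow> str \<Rightarrow> tree" where
  "lim_tree \<Phi> k s = (THE T. \<exists>j. \<Phi> j k s = Some T)"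

definition gen_tree :: "(nat \<Rightarrow> gsys) \<Rightarrow> nat \<Rightarrow> str \<Rightarrow> tree" where
  "gen_tree \<Phi> k s =
     (\<Inter>n\<in>{length s..}. \<Union>t\<in>{t. length t = n \<and> prefix s t}. lim_tree \<Phi> k t)"

definition gen_trees :: "(nat \<Rightarrow> gsys) \<Rightarrow> tree set" where
  "gen_trees \<Phi> = {gen_tree \<Phi> k s | k s. True}"

end

theory Submission
  imports Defs
begin

text \<open>
  The set of systems \<open>\<Phi>\<close> that carry, in their trees, a condition \<open>\<tau>\<close> forcing some string \<open>s\<close> into
  the name while \<open>s\<close> avoids a whole level of trees of \<open>\<Phi> K\<close> is dense. Indeed, every
  string on the top level of \<open>\<Phi> K\<close> can be given its own coordinate of a condition (the coordinates
  of \<open>u\<close> included); since the name is forced to differ from the generic real at each of these finitely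
  many coordinates, the condition can be shrunk so that a single \<open>s\<close> falls outside all the top trees,
  which are then replaced by the shrunken ones. The remaining coordinates of the shrunken condition
  are placed at the roots of unused systems. Genericity yields such a \<open>\<tau>\<close> inside the generic
  systems, and the corresponding generic trees form \<open>v\<close>.

  That this dense set lies in \<open>M\<close> is obtained from closure properties of the predicates and terms
  definable over \<open>M\<close>; finite objects are reached by closing a set under a definable operation.
\<close>

section \<open>Definability over a transitive model\<close>

text \<open>Genericity speaks only of dense sets that are elements of \<open>M\<close>, whereas
  \<open>u\<close> and \<open>U\<close> may contain generic trees, which need not be there. The
  dense set therefore refers to them through finitely many indices \<open>K\<close>,
  \<open>s0\<close>, \<open>kn n\<close>, \<open>sn n\<close> and finitely many trees
  \<open>u n\<close> in \<open>P\<close>. This loses nothing: a generic tree is contained in the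
  tree with the same index, and both componentwise inclusion and direct forcing pass to smaller
  conditions. Two constraints shape the density argument. A node of a system holds a single tree,
  while several coordinates of \<open>u\<close> may carry the same generic tree, possibly
  \<open>U\<close> itself; so the strings \<open>sn n\<close> have to be prolonged to pairwise
  distinct nodes before the condition is shrunk. And trees can be shrunk freely only on the top
  level: a lower tree must contain those above it, but at the top a smaller tree has a stem at least
  as long and still meets every requirement. Hence the systems are made taller before anything is
  replaced.\<close>

lemma hset_inject: "countable A \<Longrightarrow> countable B \<Longrightarrow> hset A = hset B \<longleftrightarrow> A = B"
  by (metis elts_hset)

lemma hset_elts [simp]: "hset (elts x) = x"
  by (simp add: elts_inject[symmetric])

lemma hset_eqI: "elts b = A \<Longrightarrow> b = hset A"
  by (drule sym) simp

lemma elts_hpair: "elts (hpair x y) = {hset {x}, hset {x, y}}"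
  by (simp add: hpair_def)

lemma hpair_inject [simp]: "hpair x y = hpair x' y' \<longleftrightarrow> x = x' \<and> y = y'"
proof
  assume "hpair x y = hpair x' y'"
  then have "{hset {x}, hset {x, y}} = {hset {x'}, hset {x', y'}}"
    by (metis elts_hpair)
  then show "x = x' \<and> y = y'"
    by (auto simp: doubleton_eq_iff hset_inject)
qed simp

lemma hnat_eq: "elts (hnat n) = hnat ` {..<n}"
  by (induction n) (auto simp: lessThan_Suc)

lemma elts_irrefl: "x \<notin> elts x"
proof
  assume "x \<in> elts x"
  then show False using wf_elts by (meson case_prodI mem_Collect_eq wf_not_refl)
qed

lemma hnat_inject [simp]: "hnat m = hnat n \<longleftrightarrow> m = n"
proof
  have less: "hnat a \<noteq> hnat b" if "a < b" for a b
  proof -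
    have "hnat a \<in> elts (hnat b)" using that by (simp only: hnat_eq) simp
    then show ?thesis using elts_irrefl by metis
  qed
  assume "hnat m = hnat n"
  then show "m = n" using less less[symmetric] by (metis linorder_neqE_nat)
qed simp

lemma hnat_mem [simp]: "hnat m \<in> elts (hnat n) \<longleftrightarrow> m < n"
  by (auto simp: hnat_eq)

abbreviation "om \<equiv> hset (range hnat)"

section \<open>Renaming of variables, and environments\<close>

primrec ren :: "(nat \<Rightarrow> nat) \<Rightarrow> fm \<Rightarrow> fm" where
  "ren f (Mem m n) = Mem (f m) (f n)"
| "ren f (Eql m n) = Eql (f m) (f n)"
| "ren f (Neg \<phi>) = Neg (ren f \<phi>)"
| "ren f (Conj \<phi> \<psi>) = Conj (ren f \<phi>) (ren f \<psi>)"
| "ren f (All n \<phi>) = All (f n) (ren f \<phi>)"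

text \<open>Injectivity rules out capture: changing the value at \<open>f n\<close> changes the
  composed assignment at \<open>n\<close> only.\<close>

lemma sat_ren: "inj f \<Longrightarrow> sat M e (ren f \<phi>) \<longleftrightarrow> sat M (e \<circ> f) \<phi>"
proof (induction \<phi> arbitrary: e)
  case (All n \<phi>)
  have "e(f n := x) \<circ> f = (e \<circ> f)(n := x)" for x
    using All.prems by (auto simp: fun_eq_iff inj_eq)
  then have "sat M (e(f n := x)) (ren f \<phi>) \<longleftrightarrow> sat M ((e \<circ> f)(n := x)) \<phi>" for x
    by (simp only: All.IH[OF All.prems])
  then show ?case by (simp only: ren.simps sat.simps)
qed (auto simp: comp_def)

text \<open>The environment outside the innermost binder. In the rules below \<open>e 0\<close> is
  the bound variable and \<open>etl e\<close> carries everything else.\<close>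

abbreviation etl :: "(nat \<Rightarrow> hc) \<Rightarrow> nat \<Rightarrow> hc" where
  "etl e \<equiv> \<lambda>n. e (Suc n)"

locale ctm =
  fixes M :: "hc set"
  assumes ctm: "ctm_ZFC' M"
begin

lemma M_trans: "x \<in> elts y \<Longrightarrow> y \<in> M \<Longrightarrow> x \<in> M"
  using ctm unfolding ctm_ZFC'_def transitive_set_def by blast

lemma elts_M: "y \<in> M \<Longrightarrow> elts y \<subseteq> M"
  using M_trans by blast

lemma M_ne: "M \<noteq> {}"
  using ctm unfolding ctm_ZFC'_def models_ZFC'_def ax_infinity_def by blast

lemma M_countable: "countable M"
  using ctm unfolding ctm_ZFC'_def by blast

lemma countable_sub_M: "A \<subseteq> M \<Longrightarrow> countable A"
  using M_countable countable_subset by blast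

text \<open>De Bruijn indices: \<open>case_nat x e\<close> binds \<open>x\<close> to index \<open>0\<close>.\<close>

inductive definable :: "((nat \<Rightarrow> hc) \<Rightarrow> bool) \<Rightarrow> bool" where
  mem0: "definable (\<lambda>e. e i \<in> elts (e j))"
| eq0: "definable (\<lambda>e. e i = e j)"
| const0: "a \<in> M \<Longrightarrow> definable (\<lambda>e. e i = a)"
| dfn_not: "definable Q \<Longrightarrow> definable (\<lambda>e. \<not> Q e)"
| dfn_conj: "definable Q \<Longrightarrow> definable R \<Longrightarrow> definable (\<lambda>e. Q e \<and> R e)"
| all0: "definable Q \<Longrightarrow> definable (\<lambda>e. \<forall>x\<in>M. Q (case_nat x e))"
| dfn_cong: "definable Q \<Longrightarrow> (\<And>e. range e \<subseteq> M \<Longrightarrow> Q e \<longleftrightarrow> Q' e) \<Longrightarrow> definable Q'"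

lemma dfn_ren: "definable Q \<Longrightarrow> definable (\<lambda>e. Q (\<lambda>n. e (f n)))"
proof (induction arbitrary: f rule: definable.induct)
  case (all0 Q)
  \<comment> \<open>Under a binder the reindexing must fix index \<open>0\<close> and act as
    \<open>f\<close> on the shifted indices.\<close>
  let ?g = "case_nat 0 (\<lambda>n. Suc (f n))"
  have "definable (\<lambda>e. \<forall>x\<in>M. Q (\<lambda>n. case_nat x e (?g n)))"
    using definable.all0[OF all0.IH[of ?g]] .
  moreover have "(\<lambda>n. case_nat x e (?g n)) = case_nat x (\<lambda>n. e (f n))" for x :: hc and e
    by (auto simp: fun_eq_iff split: nat.split)
  ultimately show ?case by simp
next
  case (dfn_cong Q Q')
  show ?case
    by (rule definable.dfn_cong[OF dfn_cong.IH[of f]]) (rule dfn_cong.hyps, auto)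
qed (auto intro: definable.intros)

text \<open>Variables \<open>3i + 1\<close> of the formula hold the environment, variables \<open>3i + 2\<close> an
  enumeration of \<open>M\<close> (the parameters), and the variables \<open>3i\<close> are bound.\<close>

definition param :: "nat \<Rightarrow> hc" where
  "param = from_nat_into M"

definition encodes_env :: "(nat \<Rightarrow> hc) \<Rightarrow> (nat \<Rightarrow> hc) \<Rightarrow> bool" where
  "encodes_env E e \<longleftrightarrow> range E \<subseteq> M \<and> (\<forall>i. E (3 * i + 1) = e i) \<and> (\<forall>i. E (3 * i + 2) = param i)"

lemma range_param: "range param = M"
  unfolding param_def using M_ne M_countable by (rule range_from_nat_into)

lemma encodes_env_exists:
  assumes "range e \<subseteq> M" shows "\<exists>E. encodes_env E e"
proof (rule exI)
  let ?E = "\<lambda>n. if n mod 3 = 1 then e (n div 3) else param (n div 3)"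
  have 1: "(3 * i + 1) mod 3 = (1::nat)" "(3 * i + 2) mod 3 = (2::nat)"
    "(3 * i + 1) div 3 = i" "(3 * i + 2) div 3 = i" for i
    by presburger+
  have "range ?E \<subseteq> M"
    using assms range_param by auto
  moreover have "?E (3 * i + 1) = e i" "?E (3 * i + 2) = param i" for i
    unfolding 1 by simp_all
  ultimately show "encodes_env ?E e"
    unfolding encodes_env_def by (intro conjI allI)
qed

text \<open>The renaming that makes variable \<open>0\<close> the head of the environment: the
  variable of index \<open>0\<close> moves to \<open>0\<close>, each later environment variable
  takes the place of its predecessor, the bound ones move up by \<open>3\<close> to free
  \<open>0\<close>, and the parameters stay.\<close>

definition shift :: "nat \<Rightarrow> nat" where
  "shift n = (if n = 1 then 0 else if n mod 3 = 0 then n + 3 else if n mod 3 = 1 then n - 3 else n)"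

lemma inj_shift: "inj shift"
proof (rule inj_on_inverseI)
  fix n :: nat
  consider "n mod 3 = 0" | "n = 1" | m where "n = m + 3" "m mod 3 = 1" | "n mod 3 = 2"
  proof -
    have "n mod 3 = 0 \<or> n = 1 \<or> (\<exists>m. n = m + 3 \<and> m mod 3 = 1) \<or> n mod 3 = 2" by presburger
    then show thesis using that by metis
  qed
  then show "(\<lambda>n. if n = 0 then 1 else if n mod 3 = 0 then n - 3 else if n mod 3 = 1 then n + 3 else n) (shift n) = n"
    by cases (auto simp: shift_def)
qed

lemma encodes_env_shift:
  assumes "encodes_env E e" "x \<in> M"
  shows "encodes_env (E(0 := x) \<circ> shift) (case_nat x e)"
proof -
  have "(E(0 := x) \<circ> shift) (3 * i + 1) = case_nat x e i" for i
  proof (cases i)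
    case (Suc j)
    have "(3 * i + 1) mod 3 = 1" by presburger
    then have "shift (3 * i + 1) = 3 * j + 1"
      unfolding shift_def using Suc by simp
    then show ?thesis using assms(1) Suc by (simp add: encodes_env_def)
  qed (simp add: shift_def)
  moreover have "(E(0 := x) \<circ> shift) (3 * i + 2) = param i" for i
  proof -
    have "(3 * i + 2) mod 3 = 2" by presburger
    then have "shift (3 * i + 2) = 3 * i + 2"
      unfolding shift_def by simp
    then show ?thesis using assms(1) by (simp add: encodes_env_def)
  qed
  moreover have "range (E(0 := x) \<circ> shift) \<subseteq> M"
    using assms by (auto simp: encodes_env_def)
  ultimately show ?thesis
    unfolding encodes_env_def by (intro conjI allI)
qed

text \<open>The values at variables \<open>3 * i\<close> are arbitrary members of \<open>M\<close>,
  so the truth of the formula cannot depend on them. The quantifier case needs this, as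
  \<open>shift\<close> permutes their roles.\<close>

definition realizes :: "fm \<Rightarrow> ((nat \<Rightarrow> hc) \<Rightarrow> bool) \<Rightarrow> bool" where
  "realizes \<phi> Q \<longleftrightarrow> (\<forall>E e. encodes_env E e \<longrightarrow> (sat M E \<phi> \<longleftrightarrow> Q e))"

lemma realizesI: "(\<And>E e. encodes_env E e \<Longrightarrow> sat M E \<phi> \<longleftrightarrow> Q e) \<Longrightarrow> realizes \<phi> Q"
  unfolding realizes_def by (intro allI impI)

lemma realizesD: "realizes \<phi> Q \<Longrightarrow> encodes_env E e \<Longrightarrow> sat M E \<phi> \<longleftrightarrow> Q e"
  unfolding realizes_def by (drule spec, drule spec, erule mp)

lemma encodes_env_in: "encodes_env E e \<Longrightarrow> E n \<in> M"
  unfolding encodes_env_def by (elim conjE) (rule subsetD, assumption, rule rangeI)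

lemma encodes_env_env: "encodes_env E e \<Longrightarrow> e i = E (3 * i + 1)"
  unfolding encodes_env_def by (elim conjE) (drule spec[of _ i], erule sym)

lemma encodes_env_range:
  assumes "encodes_env E e" shows "range e \<subseteq> M"
proof (rule image_subsetI)
  fix i show "e i \<in> M" unfolding encodes_env_env[OF assms, of i] by (rule encodes_env_in[OF assms])
qed

lemma realizes_shift:
  assumes "realizes \<phi> Q" "encodes_env E e" "x \<in> M"
  shows "sat M (E(0 := x)) (ren shift \<phi>) \<longleftrightarrow> Q (case_nat x e)"
  unfolding sat_ren[OF inj_shift] by (rule realizesD[OF assms(1) encodes_env_shift[OF assms(2,3)]])

text \<open>A constant of \<open>M\<close> is read from the variable at which \<open>param\<close>
  enumerates it; a quantifier binds variable \<open>0\<close> after renaming by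
  \<open>shift\<close>. Congruence may be restricted to environments in \<open>M\<close>, since
  those are the only ones that \<open>encodes_env\<close> admits.\<close>

lemma definable_realized: "definable Q \<Longrightarrow> \<exists>\<phi>. realizes \<phi> Q"
proof (induction rule: definable.induct)
  case (mem0 i j)
  have "realizes (Mem (3*i+1) (3*j+1)) (\<lambda>e. e i \<in> elts (e j))"
    by (rule realizesI) (simp add: encodes_env_def)
  then show ?case by (rule exI)
next
  case (eq0 i j)
  have "realizes (Eql (3*i+1) (3*j+1)) (\<lambda>e. e i = e j)"
    by (rule realizesI) (simp add: encodes_env_def)
  then show ?case by (rule exI)
next
  case (const0 a i)
  obtain k where k: "param k = a" using const0 range_param by (metis imageE)
  have "realizes (Eql (3*i+1) (3*k+2)) (\<lambda>e. e i = a)"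
    by (rule realizesI) (simp add: encodes_env_def k)
  then show ?case by (rule exI)
next
  case (dfn_not Q)
  then obtain \<phi> where \<phi>: "realizes \<phi> Q" by (elim exE)
  have "realizes (Neg \<phi>) (\<lambda>e. \<not> Q e)"
    by (rule realizesI) (simp only: sat.simps realizesD[OF \<phi>])
  then show ?case by (rule exI)
next
  case (dfn_conj Q R)
  then obtain \<phi> \<psi> where \<phi>: "realizes \<phi> Q" "realizes \<psi> R" by (elim exE)
  have "realizes (Conj \<phi> \<psi>) (\<lambda>e. Q e \<and> R e)"
    by (rule realizesI) (simp only: sat.simps realizesD[OF \<phi>(1)] realizesD[OF \<phi>(2)])
  then show ?case by (rule exI)
next
  case (all0 Q)
  then obtain \<phi> where \<phi>: "realizes \<phi> Q" by (elim exE)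
  have "realizes (All 0 (ren shift \<phi>)) (\<lambda>e. \<forall>x\<in>M. Q (case_nat x e))"
  proof (rule realizesI)
    fix E e assume "encodes_env E e"
    from realizes_shift[OF \<phi> this]
    show "sat M E (All 0 (ren shift \<phi>)) \<longleftrightarrow> (\<forall>x\<in>M. Q (case_nat x e))"
      unfolding sat.simps by (rule ball_cong[OF refl])
  qed
  then show ?case by (rule exI)
next
  case (dfn_cong Q Q')
  then obtain \<phi> where \<phi>: "realizes \<phi> Q" by (elim exE)
  have "realizes \<phi> Q'"
  proof (rule realizesI)
    fix E e assume E: "encodes_env E e"
    show "sat M E \<phi> \<longleftrightarrow> Q' e"
      unfolding realizesD[OF \<phi> E] by (rule dfn_cong.hyps(2)[OF encodes_env_range[OF E]])
  qed
  then show ?case by (rule exI)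
qed

lemma range_case_nat [simp]: "range (case_nat x e) \<subseteq> M \<longleftrightarrow> x \<in> M \<and> range e \<subseteq> M"
proof (intro iffI conjI image_subsetI)
  assume r: "range (case_nat x e) \<subseteq> M"
  show "x \<in> M" using subsetD[OF r rangeI[of _ 0]] by (simp only: nat.case)
  show "e i \<in> M" for i using subsetD[OF r rangeI[of _ "Suc i"]] by (simp only: nat.case)
next
  fix i assume x: "x \<in> M \<and> range e \<subseteq> M"
  show "case_nat x e i \<in> M"
  proof (cases i)
    case 0
    then show ?thesis using x by (simp only: nat.case)
  next
    case (Suc j)
    show ?thesis unfolding Suc nat.case using x by (elim conjE) (erule subsetD, rule rangeI)
  qed
qed

section \<open>The two schemes for definable predicates, and definable terms\<close>

lemma dfn_ball_M: "definable (\<lambda>e. Q (etl e) (e 0)) \<Longrightarrow> definable (\<lambda>e. \<forall>x\<in>M. Q e x)"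
  by (drule all0) simp

text \<open>The scheme has its argument at variable \<open>0\<close>, which is exactly where
  \<open>shift\<close> places the bound index.\<close>

lemma separation:
  assumes "definable (\<lambda>e. Q (etl e) (e 0))" "range e \<subseteq> M" "a \<in> M"
  shows "hset {x \<in> elts a. Q e x} \<in> M"
proof -
  obtain \<psi> where \<psi>: "realizes \<psi> (\<lambda>e. Q (etl e) (e 0))"
    using definable_realized[OF assms(1)] by (rule exE)
  define \<phi> where "\<phi> = ren shift \<psi>"
  have \<phi>: "sat M (E(0 := x)) \<phi> \<longleftrightarrow> Q e x" if "encodes_env E e" "x \<in> M" for E e x
    using realizes_shift[OF \<psi> that] by (simp add: \<phi>_def)
  obtain E where E: "encodes_env E e" using encodes_env_exists assms by blast
  then have rE: "range E \<subseteq> M" unfolding encodes_env_def by (elim conjE)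
  have "ax_separation M" using ctm by (simp add: ctm_ZFC'_def models_ZFC'_def)
  from this[unfolded ax_separation_def, THEN spec[of _ \<phi>], THEN spec[of _ E], THEN mp, OF rE,
      THEN bspec, OF assms(3)]
  obtain b where b: "b \<in> M" "\<forall>x\<in>M. x \<in> elts b \<longleftrightarrow> x \<in> elts a \<and> sat M (E(0 := x)) \<phi>"
    by (elim bexE)
  have "x \<in> elts b \<longleftrightarrow> x \<in> elts a \<and> Q e x" if "x \<in> M" for x
    using b(2)[rule_format, OF that] unfolding \<phi>[OF E that] .
  then have "elts b = {x \<in> elts a. Q e x}"
    using elts_M[OF b(1)] elts_M[OF assms(3)] by auto
  then have "b = hset {x \<in> elts a. Q e x}" by (rule hset_eqI)
  then show ?thesis using b(1) by (simp only:)
qed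

text \<open>Variable \<open>1\<close> is the head of the environment, so the scheme's second
  argument \<open>y\<close> is that head, and the first argument \<open>x\<close> is added at
  variable \<open>0\<close> by \<open>shift\<close>.\<close>

lemma replacement:
  assumes "definable (\<lambda>e. R (etl (etl e)) (e 0) (e 1))" "range e \<subseteq> M" "a \<in> M"
    and "\<And>x y z. x \<in> elts a \<Longrightarrow> y \<in> M \<Longrightarrow> z \<in> M \<Longrightarrow> R e x y \<Longrightarrow> R e x z \<Longrightarrow> y = z"
  shows "hset {y \<in> M. \<exists>x\<in>elts a. R e x y} \<in> M"
proof -
  obtain \<psi> where \<psi>: "realizes \<psi> (\<lambda>e. R (etl (etl e)) (e 0) (e 1))"
    using definable_realized[OF assms(1)] by (rule exE)
  define \<phi> where "\<phi> = ren shift \<psi>"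
  have \<phi>: "sat M (E(0 := x)) \<phi> \<longleftrightarrow> R (etl e) x (e 0)" if "encodes_env E e" "x \<in> M" for E e x
    using realizes_shift[OF \<psi> that] by (simp add: \<phi>_def)
  \<comment> \<open>\<open>param 0\<close> only reserves the head of the environment; it is
    overwritten by \<open>y\<close> at variable \<open>1\<close>.\<close>
  obtain E where E: "encodes_env E (case_nat (param 0) e)"
    using encodes_env_exists assms range_param by (metis range_case_nat rangeI)
  then have rE: "range E \<subseteq> M" unfolding encodes_env_def by (elim conjE)
  have E1: "encodes_env (E(1 := y)) (case_nat y e)" if "y \<in> M" for y
  proof -
    have "(E(1 := y)) (3 * i + 1) = case_nat y e i" for i
      by (cases i) (use encodes_env_env[OF E, of i] in simp_all)
    moreover have "(E(1 := y)) (3 * i + 2) = param i" for i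
      using E by (simp add: encodes_env_def)
    moreover have "range (E(1 := y)) \<subseteq> M"
      using that encodes_env_in[OF E] by (simp add: image_subset_iff)
    ultimately show ?thesis
      unfolding encodes_env_def by (intro conjI allI)
  qed
  have sat: "sat M (E(0 := x, 1 := y)) \<phi> \<longleftrightarrow> R e x y" if "x \<in> M" "y \<in> M" for x y
    using \<phi>[OF E1[OF that(2)] that(1)] by (simp add: fun_upd_twist)
  have "\<forall>x\<in>M. x \<in> elts a \<longrightarrow> (\<forall>y\<in>M. \<forall>z\<in>M. sat M (E(0 := x, 1 := y)) \<phi> \<and> sat M (E(0 := x, 1 := z)) \<phi> \<longrightarrow> y = z)"
  proof (intro ballI impI, elim conjE)
    fix x y z assume xyz: "x \<in> M" "x \<in> elts a" "y \<in> M" "z \<in> M"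
      "sat M (E(0 := x, 1 := y)) \<phi>" "sat M (E(0 := x, 1 := z)) \<phi>"
    show "y = z"
      by (rule assms(4)[OF xyz(2-4)]) (use xyz(5,6) sat[OF xyz(1)] xyz(3,4) in simp_all)
  qed
  note uniq = this
  have "ax_replacement M" using ctm by (simp add: ctm_ZFC'_def models_ZFC'_def)
  from this[unfolded ax_replacement_def, THEN spec[of _ \<phi>], THEN spec[of _ E], THEN mp, OF rE,
      THEN bspec, OF assms(3), THEN mp, OF uniq]
  obtain b where b: "b \<in> M"
      "\<forall>y\<in>M. y \<in> elts b \<longleftrightarrow> (\<exists>x\<in>M. x \<in> elts a \<and> sat M (E(0 := x, 1 := y)) \<phi>)"
    by (elim bexE)
  have "y \<in> elts b \<longleftrightarrow> (\<exists>x\<in>elts a. R e x y)" if "y \<in> M" for y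
    using b(2)[rule_format, OF that] sat[OF _ that] elts_M[OF assms(3)] by auto
  then have "elts b = {y \<in> M. \<exists>x\<in>elts a. R e x y}"
    using elts_M[OF b(1)] by auto
  then have "b = hset {y \<in> M. \<exists>x\<in>elts a. R e x y}" by (rule hset_eqI)
  then show ?thesis using b(1) by (simp only:)
qed

text \<open>Formulas have no function symbols, so a term enters through its graph, with the value at
  index \<open>0\<close>. Since the value stays in \<open>M\<close>, it can be eliminated by a
  quantifier over \<open>M\<close>.\<close>

definition definable_term :: "((nat \<Rightarrow> hc) \<Rightarrow> hc) \<Rightarrow> bool" where
  "definable_term t \<longleftrightarrow> (\<forall>e. range e \<subseteq> M \<longrightarrow> t e \<in> M) \<and> definable (\<lambda>e. e 0 = t (etl e))"

lemma tm_M: "definable_term t \<Longrightarrow> range e \<subseteq> M \<Longrightarrow> t e \<in> M"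
  by (simp add: definable_term_def)

lemma range_etl: "range e \<subseteq> M \<Longrightarrow> range (etl e) \<subseteq> M"
  by auto

lemma tm_var: "definable_term (\<lambda>e. e i)"
  unfolding definable_term_def by (auto intro: eq0)

lemma tm_const: "a \<in> M \<Longrightarrow> definable_term (\<lambda>e. a)"
  unfolding definable_term_def by (auto intro: const0)

lemma dfn_disj:
  assumes "definable Q" "definable R" shows "definable (\<lambda>e. Q e \<or> R e)"
proof -
  have "definable (\<lambda>e. \<not> (\<not> Q e \<and> \<not> R e))" by (intro dfn_not dfn_conj assms)
  then show ?thesis by simp
qed

lemma dfn_imp:
  assumes "definable Q" "definable R" shows "definable (\<lambda>e. Q e \<longrightarrow> R e)"
  using dfn_disj[OF dfn_not[OF assms(1)] assms(2)] by (simp only: imp_conv_disj)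

lemma dfn_iff:
  assumes "definable Q" "definable R" shows "definable (\<lambda>e. Q e \<longleftrightarrow> R e)"
proof -
  have "definable (\<lambda>e. (Q e \<longrightarrow> R e) \<and> (R e \<longrightarrow> Q e))" by (intro dfn_imp dfn_conj assms)
  then show ?thesis by (rule dfn_cong) blast
qed

lemma dfn_bex_M:
  assumes "definable (\<lambda>e. Q (etl e) (e 0))" shows "definable (\<lambda>e. \<exists>x\<in>M. Q e x)"
proof -
  have "definable (\<lambda>e. \<not> (\<forall>x\<in>M. \<not> Q e x))" by (intro dfn_not dfn_ball_M assms)
  then show ?thesis by simp
qed

lemma dfn_True: "definable (\<lambda>e. True)"
  by (rule dfn_cong[OF eq0[of 0 0]]) simp

text \<open>The family \<open>Q\<close> and the set \<open>F\<close> need not be definable: a finite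
  conjunction is written out. This is how finite data from outside \<open>M\<close> enter a
  formula.\<close>

lemma dfn_finite: "finite F \<Longrightarrow> (\<And>n. n \<in> F \<Longrightarrow> definable (Q n)) \<Longrightarrow> definable (\<lambda>e. \<forall>n\<in>F. Q n e)"
  by (induction F rule: finite_induct) (auto intro: dfn_True dfn_conj)

lemma dfn_eq_tm_var: "definable_term t \<Longrightarrow> definable (\<lambda>e. e i = t (\<lambda>n. e (f n)))"
  using dfn_ren[of "\<lambda>e. e 0 = t (etl e)" "case_nat i f"] by (simp add: definable_term_def)

lemma dfn_subst:
  assumes "definable (\<lambda>e. Q (etl e) (e 0))" "definable_term t" shows "definable (\<lambda>e. Q e (t e))"
proof -
  have "definable (\<lambda>e. e 0 = t (etl e))" using assms(2) by (simp add: definable_term_def)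
  then have "definable (\<lambda>e. \<exists>x\<in>M. x = t e \<and> Q e x)"
    by (intro dfn_bex_M dfn_conj assms)
  then show ?thesis
    by (rule dfn_cong) (use tm_M[OF assms(2)] in auto)
qed

lemma dfn_eq:
  assumes "definable_term t" "definable_term s" shows "definable (\<lambda>e. t e = s e)"
proof -
  have "definable (\<lambda>e. e 0 = s (etl e))"
    using assms dfn_eq_tm_var[OF assms(2)] by blast
  then show ?thesis using dfn_subst[of "\<lambda>e x. x = s e", OF _ assms(1)] by simp
qed

lemma dfn_mem:
  assumes "definable_term t" "definable_term s" shows "definable (\<lambda>e. t e \<in> elts (s e))"
proof -
  have 1: "definable (\<lambda>e. \<exists>y\<in>M. y = s (etl e) \<and> e 0 \<in> elts y)"
    by (intro dfn_bex_M dfn_conj mem0 dfn_eq_tm_var assms)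
  have "definable (\<lambda>e. e 0 \<in> elts (s (etl e)))"
    by (rule dfn_cong[OF 1]) (use tm_M[OF assms(2) range_etl] in auto)
  then show ?thesis using dfn_subst[of "\<lambda>e x. x \<in> elts (s e)", OF _ assms(1)] by simp
qed

text \<open>By transitivity a quantifier over the elements of a member of \<open>M\<close> is a
  bounded quantifier over \<open>M\<close>.\<close>

lemma dfn_ball:
  assumes "definable_term a" "definable (\<lambda>e. Q (etl e) (e 0))"
  shows "definable (\<lambda>e. \<forall>x\<in>elts (a e). Q e x)"
proof -
  have t: "definable_term (\<lambda>e. a (etl e))"
    unfolding definable_term_def using assms(1) range_etl dfn_eq_tm_var[OF assms(1)]
    by (auto simp: tm_M[OF assms(1)])
  have "definable (\<lambda>e. \<forall>x\<in>M. x \<in> elts (a e) \<longrightarrow> Q e x)"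
    by (intro dfn_ball_M dfn_imp dfn_mem assms tm_var t)
  then show ?thesis
    by (rule dfn_cong) (use tm_M[OF assms(1)] M_trans in blast)
qed

lemma dfn_bex:
  assumes "definable_term a" "definable (\<lambda>e. Q (etl e) (e 0))"
  shows "definable (\<lambda>e. \<exists>x\<in>elts (a e). Q e x)"
proof -
  have "definable (\<lambda>e. \<not> (\<forall>x\<in>elts (a e). \<not> Q e x))"
    by (intro dfn_not dfn_ball assms)
  then show ?thesis by simp
qed

lemma dfn_subset:
  assumes "definable_term t" "definable_term s" shows "definable (\<lambda>e. elts (t e) \<subseteq> elts (s e))"
proof -
  have t: "definable_term (\<lambda>e. s (etl e))"
    unfolding definable_term_def using assms(2) range_etl dfn_eq_tm_var[OF assms(2)]
    by (auto simp: tm_M[OF assms(2)])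
  have "definable (\<lambda>e. \<forall>x\<in>elts (t e). x \<in> elts (s e))"
    by (intro dfn_ball dfn_mem t assms tm_var)
  then show ?thesis by (simp add: subset_iff Ball_def)
qed

lemmas dfn_intros = dfn_ball dfn_bex dfn_ball_M dfn_bex_M dfn_not dfn_conj dfn_disj dfn_imp dfn_iff
  dfn_subset dfn_mem dfn_eq tm_var

lemma tm_etl: "definable_term t \<Longrightarrow> definable_term (\<lambda>e. t (etl e))"
  unfolding definable_term_def[of "\<lambda>e. t (etl e)"] using range_etl dfn_eq_tm_var[of t]
    by (auto simp: tm_M)

text \<open>Extensionality turns a definition of the elements into a definition of the graph. That
  the set belongs to \<open>M\<close> is a separate hypothesis, to be supplied by some
  axiom.\<close>

lemma tm_hset:
  assumes "definable (\<lambda>e. Q (etl e) (e 0))"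
    and "\<And>e. range e \<subseteq> M \<Longrightarrow> A e \<subseteq> M \<and> hset (A e) \<in> M"
    and "\<And>e x. range e \<subseteq> M \<Longrightarrow> x \<in> M \<Longrightarrow> x \<in> A e \<longleftrightarrow> Q e x"
  shows "definable_term (\<lambda>e. hset (A e))"
  unfolding definable_term_def
proof (intro conjI allI impI)
  have 1: "definable (\<lambda>e. Q (\<lambda>n. e (Suc (Suc n))) (e 0))"
    using dfn_ren[OF assms(1), of "case_nat 0 (\<lambda>n. Suc (Suc n))"] by simp
  have "definable (\<lambda>e. \<forall>x\<in>M. x \<in> elts (e 0) \<longleftrightarrow> Q (etl e) x)"
    by (intro dfn_ball_M dfn_iff 1 mem0)
  then show "definable (\<lambda>e. e 0 = hset (A (etl e)))"
  proof (rule dfn_cong)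
    fix e :: "nat \<Rightarrow> hc" assume e: "range e \<subseteq> M"
    from assms(2)[OF range_etl[OF e]] have "elts (hset (A (etl e))) = A (etl e)" "A (etl e) \<subseteq> M"
      using countable_sub_M by auto
    moreover have "elts (e 0) \<subseteq> M" using e elts_M by auto
    ultimately show "(\<forall>x\<in>M. x \<in> elts (e 0) \<longleftrightarrow> Q (etl e) x) \<longleftrightarrow> e 0 = hset (A (etl e))"
      using assms(3)[OF range_etl[OF e]] elts_inject[of "e 0" "hset (A (etl e))"] by blast
  qed
qed (use assms in auto)

lemma tm_sep:
  assumes "definable_term a" "definable (\<lambda>e. Q (etl e) (e 0))"
  shows "definable_term (\<lambda>e. hset {x \<in> elts (a e). Q e x})"
proof (rule tm_hset)
  show "definable (\<lambda>e. e 0 \<in> elts (a (etl e)) \<and> Q (etl e) (e 0))"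
    by (intro dfn_intros assms tm_etl)
next
  fix e :: "nat \<Rightarrow> hc" assume e: "range e \<subseteq> M"
  show "{x \<in> elts (a e). Q e x} \<subseteq> M \<and> hset {x \<in> elts (a e). Q e x} \<in> M"
    using separation[OF assms(2) e] tm_M[OF assms(1) e] M_trans by blast
qed auto

lemma tm_repl:
  assumes "definable_term a" "definable_term (\<lambda>e. f (etl e) (e 0))"
  shows "definable_term (\<lambda>e. hset ((\<lambda>x. f e x) ` elts (a e)))"
proof (rule tm_hset)
  have 1: "definable_term (\<lambda>e. f (\<lambda>n. e (Suc (Suc n))) (e 0))"
    unfolding definable_term_def
  proof (intro conjI allI impI)
    fix e :: "nat \<Rightarrow> hc" assume "range e \<subseteq> M"
    then have "range (case_nat (e 0) (\<lambda>n. e (Suc (Suc n)))) \<subseteq> M"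
      by auto
    from tm_M[OF assms(2) this] show "f (\<lambda>n. e (Suc (Suc n))) (e 0) \<in> M" by simp
  next
    show "definable (\<lambda>e. e 0 = f (\<lambda>n. etl e (Suc (Suc n))) (etl e 0))"
      using dfn_eq_tm_var[OF assms(2), of 0 "case_nat 1 (\<lambda>n. Suc (Suc (Suc n)))"] by simp
  qed
  show "definable (\<lambda>e. \<exists>x\<in>elts (a (etl e)). e 0 = f (etl e) x)"
    by (intro dfn_intros assms tm_etl 1)
next
  fix e :: "nat \<Rightarrow> hc" assume e: "range e \<subseteq> M"
  have f: "f e x \<in> M" if "x \<in> elts (a e)" for x
  proof -
    have "range (case_nat x e) \<subseteq> M" using that e tm_M[OF assms(1) e] M_trans by auto
    from tm_M[OF assms(2) this] show ?thesis by simp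
  qed
  have "definable (\<lambda>e. e 0 = f (\<lambda>n. etl e (Suc n)) (etl e 0))"
    using assms(2) by (simp add: definable_term_def)
  \<comment> \<open>The graph has its value at index \<open>0\<close>, whereas
    \<open>replacement\<close> expects the argument there; the renaming swaps the two.\<close>
  then have "definable (\<lambda>e. e 1 = f (\<lambda>n. e (Suc (Suc n))) (e 0))"
    by (drule_tac f="case_nat 1 (case_nat 0 (\<lambda>n. Suc (Suc n)))" in dfn_ren) simp
  from replacement[OF this e tm_M[OF assms(1) e]]
  have "hset {y \<in> M. \<exists>x\<in>elts (a e). y = f e x} \<in> M" by simp
  moreover have "{y \<in> M. \<exists>x\<in>elts (a e). y = f e x} = (\<lambda>x. f e x) ` elts (a e)"
    using f by auto
  ultimately show "(\<lambda>x. f e x) ` elts (a e) \<subseteq> M \<and> hset ((\<lambda>x. f e x) ` elts (a e)) \<in> M"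
    using f by auto
qed auto

section \<open>Pairs, unions, the true natural numbers, and iteration\<close>

lemma pairing: "x \<in> M \<Longrightarrow> y \<in> M \<Longrightarrow> hset {x, y} \<in> M"
proof -
  assume xy: "x \<in> M" "y \<in> M"
  have "ax_pairing M" using ctm by (simp add: ctm_ZFC'_def models_ZFC'_def)
  from this[unfolded ax_pairing_def, THEN bspec, OF xy(1), THEN bspec, OF xy(2)]
  obtain z where z: "z \<in> M" "\<forall>w\<in>M. w \<in> elts z \<longleftrightarrow> w = x \<or> w = y"
    by (elim bexE)
  have "elts z = {x, y}" using xy elts_M[OF z(1)] z(2) by auto
  then have "z = hset {x, y}" by (rule hset_eqI)
  then show ?thesis using z(1) by (simp only:)
qed

lemma union: "x \<in> M \<Longrightarrow> hset (\<Union>y\<in>elts x. elts y) \<in> M"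
proof -
  assume x: "x \<in> M"
  have "ax_union M" using ctm by (simp add: ctm_ZFC'_def models_ZFC'_def)
  from this[unfolded ax_union_def, THEN bspec, OF x]
  obtain u where u: "u \<in> M" "\<forall>w\<in>M. w \<in> elts u \<longleftrightarrow> (\<exists>y\<in>M. y \<in> elts x \<and> w \<in> elts y)"
    by (elim bexE)
  have "y \<in> M" "elts y \<subseteq> M" if "y \<in> elts x" for y
    using that elts_M[OF x] elts_M by auto
  then have "elts u = (\<Union>y\<in>elts x. elts y)" using elts_M[OF u(1)] u(2) by (auto, metis subsetD)
  then have "u = hset (\<Union>y\<in>elts x. elts y)" by (rule hset_eqI)
  then show ?thesis using u(1) by (simp only:)
qed

lemma tm_pair:
  assumes "definable_term t" "definable_term s" shows "definable_term (\<lambda>e. hset {t e, s e})"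
proof (rule tm_hset)
  show "definable (\<lambda>e. e 0 = t (etl e) \<or> e 0 = s (etl e))"
    by (intro dfn_intros assms tm_etl)
qed (use pairing tm_M[OF assms(1)] tm_M[OF assms(2)] in auto)

lemma tm_single:
  assumes "definable_term t" shows "definable_term (\<lambda>e. hset {t e})"
  using tm_pair[OF assms assms] by simp

lemma tm_hpair: "definable_term t \<Longrightarrow> definable_term s \<Longrightarrow> definable_term (\<lambda>e. hpair (t e) (s e))"
  unfolding hpair_def by (intro tm_pair tm_single)

lemma tm_Union:
  assumes "definable_term a" shows "definable_term (\<lambda>e. hset (\<Union>x\<in>elts (a e). elts x))"
proof (rule tm_hset)
  show "definable (\<lambda>e. \<exists>y\<in>elts (a (etl e)). e 0 \<in> elts y)"
    by (intro dfn_intros assms tm_etl)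
next
  fix e :: "nat \<Rightarrow> hc" assume e: "range e \<subseteq> M"
  show "(\<Union>x\<in>elts (a e). elts x) \<subseteq> M \<and> hset (\<Union>x\<in>elts (a e). elts x) \<in> M"
    using union tm_M[OF assms e] M_trans by blast
qed auto

lemma tm_UN:
  assumes "definable_term a" "definable_term (\<lambda>e. f (etl e) (e 0))"
  shows "definable_term (\<lambda>e. hset (\<Union>x\<in>elts (a e). elts (f e x)))"
  using tm_Union[OF tm_repl[OF assms]] by simp

lemma tm_Un:
  assumes "definable_term t" "definable_term s" shows "definable_term (\<lambda>e. hset (elts (t e) \<union> elts (s e)))"
  using tm_Union[OF tm_pair[OF assms]] by simp

lemma tm_insert:
  assumes "definable_term t" "definable_term s" shows "definable_term (\<lambda>e. hset (insert (t e) (elts (s e))))"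
  using tm_Un[OF tm_single[OF assms(1)] assms(2)] by simp

lemmas tm_intros = tm_var tm_sep tm_repl tm_hpair tm_single tm_pair tm_UN tm_Un tm_insert

lemma tm_app2:
  assumes "definable_term (\<lambda>e. g (e 0) (e 1))" "definable_term t" "definable_term s" shows "definable_term (\<lambda>e. g (t e) (s e))"
  unfolding definable_term_def
proof (intro conjI allI impI)
  fix e :: "nat \<Rightarrow> hc" assume e: "range e \<subseteq> M"
  then have "range (case_nat (t e) (case_nat (s e) e)) \<subseteq> M"
    using tm_M[OF assms(2) e] tm_M[OF assms(3) e] by auto
  from tm_M[OF assms(1) this] show "g (t e) (s e) \<in> M" by simp
next
  have 1: "definable (\<lambda>e. e (Suc (Suc 0)) = g (e (Suc 0)) (e 0))"
    using dfn_eq_tm_var[OF assms(1), of "Suc (Suc 0)" "\<lambda>n. if n = 0 then 1 else 0"] by simp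
  have "definable (\<lambda>e. \<exists>x\<in>M. \<exists>y\<in>M. x = t (etl e) \<and> y = s (etl e) \<and> e 0 = g x y)"
    by (intro dfn_intros tm_var 1 tm_etl assms)
  then show "definable (\<lambda>e. e 0 = g (t (etl e)) (s (etl e)))"
    by (rule dfn_cong) (use tm_M[OF assms(2) range_etl] tm_M[OF assms(3) range_etl] in auto)
qed

text \<open>The set given by the axiom is least only among inductive members of \<open>M\<close>. A
  nonstandard element could be removed inside \<open>M\<close>: dropping an \<in>-minimal one leaves
  a smaller inductive set that still belongs to \<open>M\<close>.\<close>

lemma omega: "hset (range hnat) \<in> M"
proof -
  have "ax_power_omega M" using ctm by (simp add: ctm_ZFC'_def models_ZFC'_def)
  then obtain w where w: "w \<in> M" "omega_in M w"
    unfolding ax_power_omega_def by (elim bexE conjE)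
  have ind: "inductive_in M w" using w by (simp add: omega_in_def)
  have sub: "elts w \<subseteq> M" using w elts_M by blast
  have zero: "hset {} \<in> elts w"
  proof -
    obtain z where "z \<in> elts w" "\<forall>w\<in>M. w \<notin> elts z" "z \<in> M"
      using ind unfolding inductive_in_def by blast
    then have "elts z = {}" using elts_M by blast
    then show ?thesis using \<open>z \<in> elts w\<close> by (metis hset_elts)
  qed
  have suc: "hset (insert y (elts y)) \<in> elts w" if "y \<in> elts w" for y
  proof -
    have y: "y \<in> M" using that sub by blast
    from ind[unfolded inductive_in_def, THEN conjunct2, THEN bspec, OF y, THEN mp, OF that]
    obtain z where z: "z \<in> M" "z \<in> elts w" "\<forall>w\<in>M. w \<in> elts z \<longleftrightarrow> w \<in> elts y \<or> w = y"
      by (elim bexE conjE)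
    have "elts z = insert y (elts y)" using elts_M[OF z(1)] elts_M[OF y] z(3) y by auto
    then have "z = hset (insert y (elts y))" by (rule hset_eqI)
    then show ?thesis using z(2) by (simp only:)
  qed
  have "hnat n \<in> elts w" for n
    using zero suc by (induction n) auto
  moreover have "x \<in> range hnat" if "x \<in> elts w" for x
  proof (rule ccontr)
    assume "x \<notin> range hnat"
    with that have "x \<in> elts w - range hnat" by blast
    then obtain x where x: "x \<in> elts w - range hnat"
      and min: "\<And>y. y \<in> elts x \<Longrightarrow> y \<notin> elts w - range hnat"
      using wfE_min[OF wf_elts, of x "elts w - range hnat"] by (metis (no_types, lifting) case_prodI mem_Collect_eq)
    have xM: "x \<in> M" using x sub by blast
    define y where "y = hset {z \<in> elts w. z \<noteq> x}"
    have "definable_term (\<lambda>e. y)"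
      unfolding y_def by (intro tm_intros dfn_intros tm_const w xM)
    then have yM: "y \<in> M" using tm_M[of "\<lambda>e. y" param] range_param by simp
    have ey: "elts y = elts w - {x}"
      unfolding y_def by (auto simp: countable_sub_M sub elts_M)
    have "inductive_in M y"
      unfolding inductive_in_def
    proof (intro conjI ballI impI)
      have "x \<noteq> hset {}" using x by (metis DiffD2 hnat.simps(1) rangeI)
      then show "\<exists>z\<in>M. z \<in> elts y \<and> (\<forall>w\<in>M. w \<notin> elts z)"
        using zero sub ey by (intro bexI[of _ "hset {}"]) auto
    next
      fix z assume z: "z \<in> M" "z \<in> elts y"
      let ?s = "hset (insert z (elts z))"
      have "?s \<in> elts w" using suc z ey by blast
      \<comment> \<open>If the successor of \<open>z\<close> were the removed \<open>x\<close>, then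
        \<open>z\<close> would be standard by minimality of \<open>x\<close>, and so would
        \<open>x\<close>.\<close>
      moreover have "?s \<noteq> x"
      proof
        assume eq: "?s = x"
        then have "z \<in> elts x" by auto
        with min have "z \<in> range hnat" using z ey by blast
        then obtain n where "z = hnat n" by blast
        then have "x = hnat (Suc n)" using eq by simp
        then show False using x by blast
      qed
      ultimately show "\<exists>v\<in>M. v \<in> elts y \<and> (\<forall>w\<in>M. w \<in> elts v \<longleftrightarrow> w \<in> elts z \<or> w = z)"
        using sub ey by (intro bexI[of _ ?s]) auto
    qed
    from w(2)[unfolded omega_in_def, THEN conjunct2, THEN bspec, OF yM, THEN mp, OF this,
        THEN bspec, OF xM, THEN mp] x
    have "x \<in> elts y" by blast
    then show False using ey by blast
  qed
  ultimately have "elts w = range hnat" by blast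
  then show ?thesis using w by (metis hset_elts)
qed

lemma hnat_M: "hnat n \<in> M"
  using omega M_trans[of "hnat n" om] by simp

lemma tm_D: "definable_term (\<lambda>e. a) \<Longrightarrow> a \<in> M"
  using tm_M[of "\<lambda>e. a" param] range_param by simp

text \<open>The recursion theorem inside \<open>M\<close>: the graph of the iteration is definable,
  so replacement on omega collects the values.\<close>

lemma iterates:
  assumes G: "definable_term (\<lambda>e. G (e 0))" and a: "a \<in> M"
  shows "hset (range (\<lambda>n. (G ^^ n) a)) \<in> M"
proof -
  have GM: "G x \<in> M" if "x \<in> M" for x
    using tm_M[OF G, of "\<lambda>_. x"] that by auto
  have GnM: "(G ^^ n) a \<in> M" for n
    by (induction n) (auto simp: a GM)
  have Gt: "definable_term (\<lambda>e. G (t e))" if "definable_term t" for t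
    using tm_app2[of "\<lambda>x y. G x", OF G that that] .
  \<comment> \<open>\<open>y\<close> is the value at \<open>n\<close> iff the pair lies in every
    \<open>f\<close> containing the start and closed under the step. Closure is asked only for
    \<open>m\<close> below \<open>n\<close>, so that a finite set of pairs can already satisfy
    it.\<close>
  define R where "R = (\<lambda>n y. \<forall>f\<in>M. hpair (hnat 0) a \<in> elts f \<and>
    (\<forall>m\<in>elts n. \<forall>z\<in>M. hpair m z \<in> elts f \<longrightarrow> hpair (hset (insert m (elts m))) (G z) \<in> elts f)
      \<longrightarrow> hpair n y \<in> elts f)"
  have dR: "definable (\<lambda>e. R (e 0) (e 1))"
    unfolding R_def One_nat_def
    by (intro dfn_intros tm_intros Gt tm_const[OF a] tm_const[OF hnat_M])
  \<comment> \<open>The true finite approximations belong to \<open>M\<close>. Testing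
    \<open>R\<close> on such an \<open>f\<close> excludes every value other than the right
    one.\<close>
  have fM: "hset ((\<lambda>m. hpair (hnat m) ((G ^^ m) a)) ` {..n}) \<in> M" for n
  proof (induction n)
    case 0
    have "definable_term (\<lambda>e. hset {hpair (hnat 0) a})"
      by (intro tm_single tm_hpair tm_const a hnat_M)
    from tm_D[OF this] show ?case by simp
  next
    case (Suc n)
    have "definable_term (\<lambda>e. hset (insert (hpair (hnat (Suc n)) ((G ^^ (Suc n)) a)) (elts (hset ((\<lambda>m. hpair (hnat m) ((G ^^ m) a)) ` {..n})))))"
      by (intro tm_insert tm_hpair tm_const Suc hnat_M GnM)
    from tm_D[OF this] show ?case by (simp add: atMost_Suc)
  qed
  have R1: "R (hnat n) ((G ^^ n) a)" for n
    unfolding R_def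
  proof (intro ballI impI, elim conjE)
    fix f assume f: "f \<in> M" "hpair (hnat 0) a \<in> elts f"
      "\<forall>m\<in>elts (hnat n). \<forall>z\<in>M. hpair m z \<in> elts f \<longrightarrow> hpair (hset (insert m (elts m))) (G z) \<in> elts f"
    have "m \<le> n \<Longrightarrow> hpair (hnat m) ((G ^^ m) a) \<in> elts f" for m
    proof (induction m)
      case (Suc m)
      then have "hpair (hset (insert (hnat m) (elts (hnat m)))) (G ((G ^^ m) a)) \<in> elts f"
        using f(3) GnM by (intro f(3)[rule_format]) auto
      then show ?case by simp
    qed (use f in simp)
    then show "hpair (hnat n) ((G ^^ n) a) \<in> elts f" by simp
  qed
  have R2: "y = (G ^^ n) a" if "R (hnat n) y" for n y
  proof -
    let ?f = "hset ((\<lambda>m. hpair (hnat m) ((G ^^ m) a)) ` {..n})"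
    have "hpair (hnat n) y \<in> elts ?f"
    proof (rule that[unfolded R_def, rule_format, OF fM], intro conjI ballI impI)
      fix m z assume "m \<in> elts (hnat n)" "hpair m z \<in> elts ?f"
      then obtain k where k: "k < n" "m = hnat k" "z = (G ^^ k) a"
        by (auto simp: hnat_eq)
      have "hpair (hset (insert m (elts m))) (G z) = hpair (hnat (Suc k)) ((G ^^ (Suc k)) a)"
        using k by simp
      then show "hpair (hset (insert m (elts m))) (G z) \<in> elts ?f"
        using k(1) by (auto intro!: image_eqI[of _ _ "Suc k"] simp del: hnat.simps)
    qed (auto intro!: image_eqI[of _ _ 0])
    then show ?thesis by auto
  qed
  have "hset {y \<in> M. \<exists>x\<in>elts om. R x y} \<in> M"
    by (rule replacement[of "\<lambda>_. R" param]) (use dR range_param omega in \<open>auto dest!: R2\<close>)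
  also have "{y \<in> M. \<exists>x\<in>elts om. R x y} = range (\<lambda>n. (G ^^ n) a)"
    using R1 R2 GnM by auto
  finally show ?thesis .
qed

end

text \<open>Only the left argument is iterated. Strings, finitely supported functions and finite
  maps all arise from one start object by single updates with entries from \<open>Y\<close>.\<close>

inductive_set clos :: "(hc \<Rightarrow> hc \<Rightarrow> hc) \<Rightarrow> hc \<Rightarrow> hc set \<Rightarrow> hc set" for g a Y where
  base: "a \<in> clos g a Y"
| step: "x \<in> clos g a Y \<Longrightarrow> y \<in> Y \<Longrightarrow> g x y \<in> clos g a Y"

context ctm
begin

lemma set_in_sub: "set_in X M \<Longrightarrow> X \<subseteq> M"
  unfolding set_in_def using elts_M by fastforce

lemma set_in_clos:
  assumes g: "definable_term (\<lambda>e. g (e 0) (e 1))" and a: "a \<in> M" and Y: "set_in Y M"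
  shows "set_in (clos g a Y) M"
proof -
  \<comment> \<open>One closure step performed on a whole set at once. Every member of
    \<open>clos\<close> needs finitely many steps, so the closure is the union of the iterates of
    \<open>G\<close>.\<close>
  define G where "G X = hset (elts X \<union> elts (hset (\<Union>x\<in>elts X. elts (hset ((\<lambda>y. g x y) ` elts (hset Y))))))" for X
  have YM: "hset Y \<in> M" "elts (hset Y) = Y" using Y by (auto simp: set_in_def)
  have cY: "countable Y" using Y by (simp add: set_in_def)
  have 1: "hset (range (\<lambda>n. (G ^^ n) (hset {a}))) \<in> M"
    unfolding G_def
    by (intro iterates tm_intros tm_app2[OF g] tm_const YM tm_D[OF tm_single[OF tm_const[OF a]]])
  have eG: "elts (G X) = elts X \<union> {g x y | x y. x \<in> elts X \<and> y \<in> Y}" for X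
    unfolding G_def YM(2) using cY by auto
  have sub: "elts ((G ^^ n) (hset {a})) \<subseteq> clos g a Y" for n
    by (induction n) (auto simp: eG intro: clos.intros)
  have "\<exists>n. x \<in> elts ((G ^^ n) (hset {a}))" if "x \<in> clos g a Y" for x
    using that
  proof induction
    case base
    show ?case by (rule exI[of _ 0]) simp
  next
    case (step x y)
    then obtain n where "x \<in> elts ((G ^^ n) (hset {a}))" by blast
    then have "g x y \<in> elts ((G ^^ Suc n) (hset {a}))" using step by (auto simp: eG)
    then show ?case by blast
  qed
  then have "clos g a Y = (\<Union>n. elts ((G ^^ n) (hset {a})))"
    using subsetD[OF sub] by auto
  then have 2: "clos g a Y = (\<Union>x\<in>elts (hset (range (\<lambda>n. (G ^^ n) (hset {a})))). elts x)"
    by simp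
  have "hset (clos g a Y) \<in> M" unfolding 2 by (rule union[OF 1])
  moreover have "countable (clos g a Y)" unfolding 2 by simp
  ultimately show ?thesis by (simp add: set_in_def)
qed

end

section \<open>Codes of trees, conditions and systems\<close>

lemma hbit_inject [simp]: "hbit i = hbit j \<longleftrightarrow> i = j"
  unfolding hbit_def by simp

lemma elts_hstr: "elts (hstr s) = (\<lambda>n. hpair (hnat n) (hbit (s ! n))) ` {..<length s}"
  unfolding hstr_def by (subst elts_hset) (auto simp: setcompr_eq_image)

lemma hpair_hstr [simp]: "hpair (hnat n) (hbit i) \<in> elts (hstr s) \<longleftrightarrow> n < length s \<and> s ! n = i"
  by (auto simp: elts_hstr)

text \<open>A string is coded by the graph of a function, so extension is inclusion of graphs. This
  makes \<open>prefix\<close> expressible without mentioning lengths.\<close>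

lemma hstr_subset [simp]: "elts (hstr s) \<subseteq> elts (hstr t) \<longleftrightarrow> prefix s t"
proof
  assume "elts (hstr s) \<subseteq> elts (hstr t)"
  then have *: "n < length t \<and> t ! n = s ! n" if "n < length s" for n
    using that hpair_hstr[of n "s ! n" s] hpair_hstr[of n "s ! n" t] by blast
  then have "length s \<le> length t" by (metis linorder_not_less order_less_irrefl)
  then have "s = take (length s) t" using * by (intro nth_equalityI) auto
  then show "prefix s t" by (metis take_is_prefix)
next
  assume "prefix s t"
  then show "elts (hstr s) \<subseteq> elts (hstr t)"
    by (auto simp: elts_hstr prefix_def nth_append intro!: image_eqI)
qed

lemma hstr_inject [simp]: "hstr s = hstr t \<longleftrightarrow> s = t"
  using hstr_subset[of s t] hstr_subset[of t s] by (metis order_refl prefix_order.antisym)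

lemma elts_htree [simp]: "elts (htree T) = hstr ` T"
  unfolding htree_def by simp

lemma htree_inject [simp]: "htree T = htree T' \<longleftrightarrow> T = T'"
proof
  assume "htree T = htree T'"
  then have "hstr ` T = hstr ` T'" by (metis elts_htree)
  then show "T = T'" by (simp add: inj_image_eq_iff inj_def)
qed simp

lemma hstr_image_subset [simp]: "hstr ` T \<subseteq> hstr ` T' \<longleftrightarrow> T \<subseteq> T'"
  by (auto simp: image_subset_iff)

text \<open>The common form of \<open>hcond\<close> and \<open>hgsys\<close>, so that one argument
  puts both finite support products into \<open>M\<close>.\<close>

definition hfun :: "('a \<Rightarrow> hc) \<Rightarrow> (nat \<Rightarrow> 'a) \<Rightarrow> hc" where
  "hfun cod f = hset {hpair (hnat n) (cod (f n)) | n. True}"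

lemma hcond_hfun: "hcond = hfun htree"
  by (auto simp: fun_eq_iff hcond_def hfun_def)

lemma hgsys_hfun: "hgsys = hfun htsys"
  by (auto simp: fun_eq_iff hgsys_def hfun_def)

lemma elts_hfun: "elts (hfun cod f) = range (\<lambda>n. hpair (hnat n) (cod (f n)))"
  unfolding hfun_def by (subst elts_hset) (auto simp: full_SetCompr_eq)

lemma hpair_hcond [simp]: "hpair (hnat n) (htree T) \<in> elts (hcond \<tau>) \<longleftrightarrow> \<tau> n = T"
  by (auto simp: hcond_hfun elts_hfun)

lemma elts_htsys: "elts (htsys \<phi>) = {hpair (hstr s) (htree T) | s T. \<phi> s = Some T}"
proof -
  have "{hpair (hstr s) (htree T) | s T. \<phi> s = Some T} = (\<lambda>s. hpair (hstr s) (htree (the (\<phi> s)))) ` dom \<phi>"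
    by force
  then show ?thesis
    unfolding htsys_def by (simp add: countable_image)
qed

lemma hpair_htsys [simp]: "hpair (hstr s) (htree T) \<in> elts (htsys \<phi>) \<longleftrightarrow> \<phi> s = Some T"
  by (auto simp: elts_htsys)

lemma htsys_inject [simp]: "htsys \<phi> = htsys \<psi> \<longleftrightarrow> \<phi> = \<psi>"
proof
  assume "htsys \<phi> = htsys \<psi>"
  then have "\<phi> s = Some T \<longleftrightarrow> \<psi> s = Some T" for s T by (metis hpair_htsys)
  then have "\<phi> s = \<psi> s" for s by (metis not_Some_eq)
  then show "\<phi> = \<psi>" by blast
qed simp

lemma hpair_hgsys [simp]: "hpair (hnat n) (htsys \<phi>) \<in> elts (hgsys \<Phi>) \<longleftrightarrow> \<Phi> n = \<phi>"
  by (auto simp: hgsys_hfun elts_hfun)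

context ctm
begin

section \<open>Sets of codes that are elements of \<open>M\<close>\<close>

lemma set_in_mem: "set_in X M \<Longrightarrow> x \<in> X \<Longrightarrow> x \<in> M"
  using set_in_sub by blast

lemma elts_set_in: "set_in X M \<Longrightarrow> elts (hset X) = X"
  by (simp add: set_in_def)

lemma set_inD: "set_in X M \<Longrightarrow> hset X \<in> M"
  by (simp add: set_in_def)

lemma set_in_elts: "x \<in> M \<Longrightarrow> set_in (elts x) M"
  by (simp add: set_in_def)

lemma set_in_tm: "X \<subseteq> M \<Longrightarrow> definable_term (\<lambda>e. hset X) \<Longrightarrow> set_in X M"
  by (simp add: set_in_def tm_D countable_sub_M)

lemma set_in_sep:
  assumes "set_in X M" "definable (\<lambda>e. Q (e 0))" shows "set_in {x \<in> X. Q x} M"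
proof -
  have "definable_term (\<lambda>e. hset {x \<in> elts (hset X). Q x})"
    by (intro tm_sep tm_const set_inD assms)
  then have "definable_term (\<lambda>e. hset {x \<in> X. Q x})"
    by (simp only: elts_set_in[OF assms(1)])
  then show ?thesis
    by (rule set_in_tm[rotated]) (use set_in_sub[OF assms(1)] in blast)
qed

lemma hpair_M: "a \<in> M \<Longrightarrow> b \<in> M \<Longrightarrow> hpair a b \<in> M"
  using tm_D[OF tm_hpair[OF tm_const tm_const]] .

lemma hpair_MD: "hpair a b \<in> M \<Longrightarrow> a \<in> M \<and> b \<in> M"
proof -
  assume "hpair a b \<in> M"
  then have "hset {a, b} \<in> M" by (rule M_trans[rotated]) (simp add: elts_hpair)
  moreover have "elts (hset {a, b}) = {a, b}" by simp
  ultimately show ?thesis using M_trans by blast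
qed

lemma set_in_prod:
  assumes "set_in X M" "set_in Y M"
  shows "set_in {hpair x y | x y. x \<in> X \<and> y \<in> Y} M"
proof (rule set_in_tm)
  show "{hpair x y | x y. x \<in> X \<and> y \<in> Y} \<subseteq> M"
    using assms[THEN set_in_sub] hpair_M by blast
  have c: "countable X" "countable Y" using assms by (simp_all add: set_in_def)
  have "definable_term (\<lambda>e. hset (\<Union>x\<in>elts (hset X). elts (hset ((\<lambda>y. hpair x y) ` elts (hset Y)))))"
    by (intro tm_intros tm_const set_inD assms)
  moreover have "(\<Union>x\<in>elts (hset X). elts (hset ((\<lambda>y. hpair x y) ` elts (hset Y)))) = {hpair x y | x y. x \<in> X \<and> y \<in> Y}"
    using c by auto
  ultimately show "definable_term (\<lambda>e. hset {hpair x y | x y. x \<in> X \<and> y \<in> Y})" by (simp only:)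
qed

abbreviation "hbits \<equiv> hset (range hbit)"

lemma hbit_M: "hbit i \<in> M"
  by (simp add: hbit_def hnat_M del: hnat.simps)

lemma hbits_M: "hbits \<in> M"
proof -
  have "definable_term (\<lambda>e. hset {hbit False, hbit True})"
    by (intro tm_pair tm_const hbit_M)
  moreover have "range hbit = {hbit False, hbit True}"
    by (simp add: UNIV_bool)
  ultimately show ?thesis using tm_D by simp
qed

lemma set_in_str: "set_in (range hstr) M"
proof -
  \<comment> \<open>Appending a bit: the inner set is the domain of \<open>s\<close>, which as a von
    Neumann natural is its length and hence the next position.\<close>
  define g where "g s i = hset (insert (hpair (hset {m \<in> elts om. \<exists>j\<in>elts hbits. hpair m j \<in> elts s}) i) (elts s))" for s i
  have g: "g (hstr s) (hbit i) = hstr (s @ [i])" for s i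
  proof -
    have "{m \<in> elts om. \<exists>j\<in>elts hbits. hpair m j \<in> elts (hstr s)} = elts (hnat (length s))"
      by (auto simp: hnat_eq)
    then have "g (hstr s) (hbit i) = hset (insert (hpair (hnat (length s)) (hbit i)) (elts (hstr s)))"
      unfolding g_def by (simp only: hset_elts)
    also have "\<dots> = hstr (s @ [i])"
      by (rule sym, rule hset_eqI) (auto simp: elts_hstr lessThan_Suc nth_append)
    finally show ?thesis .
  qed
  have "set_in (clos g (hnat 0) (range hbit)) M"
  proof (rule set_in_clos)
    show "definable_term (\<lambda>e. g (e 0) (e 1))"
      unfolding g_def One_nat_def
      by (intro tm_intros dfn_intros tm_const omega hbits_M)
  qed (use hbits_M in \<open>auto simp: set_in_def intro!: hnat_M simp del: hnat.simps\<close>)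
  moreover have nil: "hnat 0 = hstr []" by (simp add: hstr_def)
  have "hstr s \<in> clos g (hstr []) (range hbit)" for s
    by (induction s rule: rev_induct) (auto intro: clos.base clos.step simp flip: g)
  moreover have "x \<in> range hstr" if "x \<in> clos g (hstr []) (range hbit)" for x
    using that by induction (auto simp: g)
  ultimately show ?thesis unfolding nil by (metis subsetI subset_antisym image_subsetI)
qed

abbreviation "hstrs \<equiv> hset (range hstr)"

lemma hstrs_M: "hstrs \<in> M" by (rule set_inD[OF set_in_str])

lemma hstr_M: "hstr s \<in> M" using set_in_mem[OF set_in_str] by blast

text \<open>Function update on codes, with \<open>y\<close> the new pair: pairs with the same first
  component are discarded before \<open>y\<close> is inserted. Searching the components in
  \<open>M\<close> keeps the operation definable and misses nothing, as components of a pair in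
  \<open>M\<close> are in \<open>M\<close>.\<close>

definition hupd :: "hc \<Rightarrow> hc \<Rightarrow> hc" where
  "hupd f y = hset (insert y (elts (hset {z \<in> elts f. \<not> (\<exists>n\<in>M. \<exists>a\<in>M. \<exists>b\<in>M. z = hpair n a \<and> y = hpair n b)})))"

lemma tm_hupd: "definable_term (\<lambda>e. hupd (e 0) (e 1))"
  unfolding hupd_def One_nat_def by (intro tm_intros dfn_intros)

lemma elts_hupd:
  assumes "f \<in> M" "hpair n b \<in> M"
  shows "elts (hupd f (hpair n b)) = insert (hpair n b) {z \<in> elts f. \<forall>a. z \<noteq> hpair n a}"
proof -
  have "(\<exists>n'\<in>M. \<exists>a\<in>M. \<exists>b'\<in>M. z = hpair n' a \<and> hpair n b = hpair n' b') \<longleftrightarrow> (\<exists>a. z = hpair n a)"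
    if z: "z \<in> elts f" for z
  proof
    assume "\<exists>a. z = hpair n a"
    then obtain a where a: "z = hpair n a" by blast
    have "n \<in> M" "a \<in> M" "b \<in> M"
      using hpair_MD[OF M_trans[OF z assms(1), unfolded a]] hpair_MD[OF assms(2)] by simp_all
    then show "\<exists>n'\<in>M. \<exists>a\<in>M. \<exists>b'\<in>M. z = hpair n' a \<and> hpair n b = hpair n' b'"
      using a by blast
  qed auto
  then have *: "{z \<in> elts f. \<not> (\<exists>n'\<in>M. \<exists>a\<in>M. \<exists>b'\<in>M. z = hpair n' a \<and> hpair n b = hpair n' b')} =
      {z \<in> elts f. \<forall>a. z \<noteq> hpair n a}" by auto
  have c: "countable {z \<in> elts f. \<forall>a. z \<noteq> hpair n a}"
    by (rule countable_subset[of _ "elts f"]) auto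
  show ?thesis unfolding hupd_def * by (simp add: c)
qed

text \<open>A function of finite support is reached from the constant \<open>b\<close> by one update
  per point of the support. The instances are conditions, with default \<open>UNIV\<close>, and
  members of \<open>spg\<close>, with the empty system as default.\<close>

lemma set_in_hfun:
  assumes "set_in (cod ` A) M" and b: "b \<in> A"
  shows "set_in (hfun cod ` {f. range f \<subseteq> A \<and> finite {n. f n \<noteq> b}}) M"
proof -
  let ?b = "hfun cod (\<lambda>_. b)"
  let ?Y = "{hpair x y | x y. x \<in> range hnat \<and> y \<in> cod ` A}"
  have cod: "cod a \<in> M" if "a \<in> A" for a using that set_in_mem[OF assms(1)] by blast
  have "definable_term (\<lambda>e. hset ((\<lambda>n. hpair n (cod b)) ` elts om))"
    by (intro tm_intros tm_const omega cod b)
  moreover have "?b = hset ((\<lambda>n. hpair n (cod b)) ` elts om)"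
    by (rule hset_eqI) (auto simp: elts_hfun)
  ultimately have bM: "?b \<in> M" using tm_D by simp
  have Y: "set_in ?Y M"
    using set_in_prod[OF set_in_elts[OF omega] assms(1)] by simp
  have clos: "set_in (clos hupd ?b ?Y) M"
    by (rule set_in_clos[OF tm_hupd bM Y])
  have upd: "hupd (hfun cod f) (hpair (hnat n) (cod a)) = hfun cod (f(n := a))"
    if "hfun cod f \<in> M" "a \<in> A" for f n a
    using elts_hupd[OF that(1) hpair_M[OF hnat_M cod[OF that(2)]], of n]
    by (intro elts_inject[THEN iffD1]) (auto simp: elts_hfun)
  have sub1: "hfun cod f \<in> clos hupd ?b ?Y" if "finite N" "range f \<subseteq> A" "{n. f n \<noteq> b} = N" for N f
    using that
  proof (induction N arbitrary: f rule: finite_induct)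
    case empty
    then have "f = (\<lambda>_. b)" by auto
    then show ?case by (auto intro: clos.base)
  next
    case (insert n N)
    let ?f = "f(n := b)"
    have 1: "hfun cod ?f \<in> clos hupd ?b ?Y"
      using insert by (intro insert.IH) (auto simp: b)
    have fn: "f n \<in> A" using insert by auto
    have eq: "hupd (hfun cod ?f) (hpair (hnat n) (cod (f n))) = hfun cod f"
      using upd[OF set_in_mem[OF clos 1] fn] by simp
    have "hpair (hnat n) (cod (f n)) \<in> ?Y" using fn by blast
    from clos.step[OF 1 this] show ?case unfolding eq .
  qed
  have sub2: "\<exists>f. x = hfun cod f \<and> range f \<subseteq> A \<and> finite {n. f n \<noteq> b}" if "x \<in> clos hupd ?b ?Y" for x
    using that
  proof induction
    case base
    show ?case using b by (intro exI[of _ "\<lambda>_. b"]) auto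
  next
    case (step x y)
    then obtain f n a where f: "x = hfun cod f" "range f \<subseteq> A" "finite {n. f n \<noteq> b}"
      "a \<in> A" "y = hpair (hnat n) (cod a)" by blast
    then have "hupd x y = hfun cod (f(n := a))"
      using upd set_in_mem[OF clos step(1)] by simp
    moreover have "{m. (f(n := a)) m \<noteq> b} \<subseteq> insert n {n. f n \<noteq> b}" by auto
    then have "finite {m. (f(n := a)) m \<noteq> b}" by (rule finite_subset) (simp add: f)
    moreover have "range (f(n := a)) \<subseteq> A" using f by auto
    ultimately show ?case by (intro exI[of _ "f(n := a)"] conjI)
  qed
  have "clos hupd ?b ?Y = hfun cod ` {f. range f \<subseteq> A \<and> finite {n. f n \<noteq> b}}"
  proof (intro equalityI subsetI)
    fix x assume "x \<in> clos hupd ?b ?Y"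
    from sub2[OF this] show "x \<in> hfun cod ` {f. range f \<subseteq> A \<and> finite {n. f n \<noteq> b}}"
      by (elim exE conjE) (rule image_eqI, assumption, simp)
  next
    fix x assume "x \<in> hfun cod ` {f. range f \<subseteq> A \<and> finite {n. f n \<noteq> b}}"
    then show "x \<in> clos hupd ?b ?Y"
      by (elim imageE CollectE conjE) (simp only:, rule sub1[OF _ _ refl])
  qed
  then show ?thesis using clos by simp
qed

text \<open>The same closure argument, starting from the empty map and adding one entry at a
  time.\<close>

lemma set_in_finite_maps:
  assumes "set_in (htree ` P) M"
  shows "set_in (htsys ` {\<phi>. finite (dom \<phi>) \<and> ran \<phi> \<subseteq> P}) M"
proof -
  let ?b = "htsys Map.empty"
  let ?Y = "{hpair x y | x y. x \<in> range hstr \<and> y \<in> htree ` P}"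
  have cod: "htree a \<in> M" if "a \<in> P" for a using that set_in_mem[OF assms(1)] by blast
  have "?b = hnat 0" by (simp add: htsys_def)
  then have bM: "?b \<in> M" using hnat_M by metis
  have Y: "set_in ?Y M"
    using set_in_prod[OF set_in_str assms(1)] by simp
  have clos: "set_in (clos hupd ?b ?Y) M"
    by (rule set_in_clos[OF tm_hupd bM Y])
  have upd: "hupd (htsys f) (hpair (hstr n) (htree a)) = htsys (f(n \<mapsto> a))"
    if "htsys f \<in> M" "a \<in> P" for f n a
    using elts_hupd[OF that(1) hpair_M[OF hstr_M cod[OF that(2)]], of n]
    by (intro elts_inject[THEN iffD1]) (auto simp: elts_htsys split: if_splits)
  have sub1: "htsys f \<in> clos hupd ?b ?Y" if "finite N" "ran f \<subseteq> P" "dom f = N" for N f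
    using that
  proof (induction N arbitrary: f rule: finite_induct)
    case empty
    then show ?case by (auto intro: clos.base)
  next
    case (insert n N)
    let ?f = "f(n := None)"
    have 1: "htsys ?f \<in> clos hupd ?b ?Y"
      using insert by (intro insert.IH) (auto simp: ran_def split: if_splits)
    obtain a where a: "f n = Some a" using insert.prems by blast
    then have "a \<in> P" using insert.prems(1) by (auto intro: ranI)
    note a = a this
    have eq: "hupd (htsys ?f) (hpair (hstr n) (htree a)) = htsys f"
      using upd[OF set_in_mem[OF clos 1] a(2)] a(1) by (simp add: fun_upd_idem)
    have "hpair (hstr n) (htree a) \<in> ?Y" using a by blast
    from clos.step[OF 1 this] show ?case unfolding eq .
  qed
  have sub2: "\<exists>f. x = htsys f \<and> finite (dom f) \<and> ran f \<subseteq> P" if "x \<in> clos hupd ?b ?Y" for x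
    using that
  proof induction
    case base
    show ?case by (intro exI[of _ Map.empty]) auto
  next
    case (step x y)
    then obtain f n a where f: "x = htsys f" "finite (dom f)" "ran f \<subseteq> P"
      "a \<in> P" "y = hpair (hstr n) (htree a)" by blast
    then have "hupd x y = htsys (f(n \<mapsto> a))"
      using upd set_in_mem[OF clos step(1)] by simp
    moreover have "ran (f(n \<mapsto> a)) \<subseteq> P" using f by (auto simp: ran_def split: if_splits)
    moreover have "finite (dom (f(n \<mapsto> a)))" using f by simp
    ultimately show ?case by (intro exI[of _ "f(n \<mapsto> a)"] conjI)
  qed
  have "clos hupd ?b ?Y = htsys ` {\<phi>. finite (dom \<phi>) \<and> ran \<phi> \<subseteq> P}"
  proof (intro equalityI subsetI)
    fix x assume "x \<in> clos hupd ?b ?Y"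
    from sub2[OF this] show "x \<in> htsys ` {\<phi>. finite (dom \<phi>) \<and> ran \<phi> \<subseteq> P}"
      by (elim exE conjE) (rule image_eqI, assumption, simp)
  next
    fix x assume "x \<in> htsys ` {\<phi>. finite (dom \<phi>) \<and> ran \<phi> \<subseteq> P}"
    then show "x \<in> clos hupd ?b ?Y"
      by (elim imageE CollectE conjE) (simp only:, rule sub1[OF _ _ refl])
  qed
  then show ?thesis using clos by simp
qed

section \<open>First-order descriptions of length, appending and stem\<close>

definition haslen :: "hc \<Rightarrow> hc \<Rightarrow> bool" where
  "haslen s m \<longleftrightarrow> (\<forall>k\<in>elts om. k \<in> elts m \<longleftrightarrow> (\<exists>i\<in>elts hbits. hpair k i \<in> elts s))"

definition happend :: "hc \<Rightarrow> hc \<Rightarrow> hc \<Rightarrow> bool" where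
  "happend s i q \<longleftrightarrow> (\<exists>m\<in>elts om. haslen s m \<and> (\<forall>z\<in>M. z \<in> elts q \<longleftrightarrow> z = hpair m i \<or> z \<in> elts s))"

text \<open>Replaces the maximality clause of \<open>stem\<close>: in a perfect tree the stem is the
  string comparable with every node and having both immediate successors in the tree, see
  \<open>stem_iff\<close>.\<close>

definition hstem :: "hc \<Rightarrow> hc \<Rightarrow> bool" where
  "hstem r T \<longleftrightarrow> (\<forall>t\<in>elts T. elts r \<subseteq> elts t \<or> elts t \<subseteq> elts r) \<and>
     (\<forall>i\<in>elts hbits. \<exists>q\<in>elts T. happend r i q)"

lemma dfn_haslen: "definable (\<lambda>e. haslen (e i) (e j))"
  unfolding haslen_def by (intro dfn_intros tm_intros tm_const omega hbits_M)

lemma dfn_happend: "definable (\<lambda>e. happend (e i) (e j) (e k))"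
  unfolding happend_def by (intro dfn_intros dfn_haslen tm_intros tm_const omega)

lemma dfn_hstem: "definable (\<lambda>e. hstem (e i) (e j))"
  unfolding hstem_def by (intro dfn_intros dfn_happend tm_intros tm_const hbits_M)

lemma haslen_iff [simp]: "haslen (hstr s) (hnat m) \<longleftrightarrow> m = length s"
proof -
  have "haslen (hstr s) (hnat m) \<longleftrightarrow> (\<forall>k. k < m \<longleftrightarrow> k < length s)"
    unfolding haslen_def by auto
  also have "\<dots> \<longleftrightarrow> m = length s"
    by (metis linorder_neqE_nat less_irrefl)
  finally show ?thesis .
qed

lemma happend_iff [simp]: "happend (hstr s) (hbit i) (hstr q) \<longleftrightarrow> q = s @ [i]"
proof -
  have "happend (hstr s) (hbit i) (hstr q) \<longleftrightarrow>
      (\<forall>z\<in>M. z \<in> elts (hstr q) \<longleftrightarrow> z = hpair (hnat (length s)) (hbit i) \<or> z \<in> elts (hstr s))"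
    unfolding happend_def by auto
  also have "\<dots> \<longleftrightarrow> (\<forall>z\<in>M. z \<in> elts (hstr q) \<longleftrightarrow> z \<in> elts (hstr (s @ [i])))"
  proof -
    have "elts (hstr (s @ [i])) = insert (hpair (hnat (length s)) (hbit i)) (elts (hstr s))"
      by (auto simp: elts_hstr lessThan_Suc nth_append)
    then show ?thesis by simp
  qed
  also have "\<dots> \<longleftrightarrow> hstr q = hstr (s @ [i])"
    unfolding elts_inject[symmetric] using elts_M[OF hstr_M] by blast
  finally show ?thesis by simp
qed

lemma hstem_iff [simp]: "hstem (hstr r) (htree T) \<longleftrightarrow>
    (\<forall>t\<in>T. prefix r t \<or> prefix t r) \<and> r @ [False] \<in> T \<and> r @ [True] \<in> T"
  unfolding hstem_def by (auto simp: all_bool_eq)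

end

section \<open>Splitting systems and density\<close>

abbreviation comparable :: "str \<Rightarrow> str \<Rightarrow> bool" where
  "comparable s t \<equiv> prefix s t \<or> prefix t s"

section \<open>Stems of perfect trees\<close>

lemma PT_tree: "T \<in> PT \<Longrightarrow> t \<in> T \<Longrightarrow> prefix s t \<Longrightarrow> s \<in> T"
  unfolding PT_def is_tree_def by blast

text \<open>Take a shortest splitting node. A node incomparable with it would make the tree split
  already at their longest common initial segment.\<close>

lemma PT_split_node:
  assumes T: "T \<in> PT"
  shows "\<exists>r. r @ [False] \<in> T \<and> r @ [True] \<in> T \<and> (\<forall>t\<in>T. comparable r t)"
proof -
  define S where "S r \<longleftrightarrow> r @ [False] \<in> T \<and> r @ [True] \<in> T" for r
  have "\<exists>r. S r" using T unfolding PT_def S_def by blast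
  then obtain r where r: "S r" and min: "\<And>q. S q \<Longrightarrow> length r \<le> length q"
    using ex_has_least_nat[of S _ length] by metis
  have "comparable r t" if t: "t \<in> T" for t
  proof (rule ccontr)
    assume "\<not> comparable r t"
    then have "r \<parallel> t" by blast
    from parallel_decomp[OF this]
    obtain p b bs c cs where p: "b \<noteq> c" "r = p @ b # bs" "t = p @ c # cs"
      by (elim exE conjE)
    have "r \<in> T" using PT_tree[OF T] r unfolding S_def by (metis prefixI)
    have "p @ [b] \<in> T" by (rule PT_tree[OF T \<open>r \<in> T\<close>]) (simp add: p)
    moreover have "p @ [c] \<in> T" by (rule PT_tree[OF T t]) (simp add: p)
    ultimately have "S p" unfolding S_def using p(1) by (cases b; cases c) auto
    from min[OF this] show False using p by simp
  qed
  then show ?thesis using r unfolding S_def by blast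
qed

text \<open>A string running past \<open>r\<close> follows at most one of the two successors and is
  incomparable with the other.\<close>

lemma split_node_maximal:
  assumes "r @ [False] \<in> T" "r @ [True] \<in> T" "\<forall>t\<in>T. comparable q t"
  shows "prefix q r"
proof -
  have "comparable q (r @ [False])" "comparable q (r @ [True])" using assms by auto
  then show ?thesis
    by (auto simp: prefix_snoc) (auto simp: prefix_def)
qed

lemma restr_eq_iff: "T = restr T r \<longleftrightarrow> (\<forall>t\<in>T. comparable r t)"
  unfolding restr_def by blast

lemma stem_eqI:
  assumes T: "T \<in> PT" and r: "r @ [False] \<in> T" "r @ [True] \<in> T" "\<forall>t\<in>T. comparable r t"
  shows "stem T = r"
  unfolding stem_def restr_eq_iff
proof (rule the_equality)
  have "r \<in> T" using PT_tree[OF T r(1)] by simp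
  then show "r \<in> T \<and> (\<forall>t\<in>T. comparable r t) \<and> (\<forall>q\<in>T. (\<forall>t\<in>T. comparable q t) \<longrightarrow> prefix q r)"
    using r split_node_maximal[OF r(1,2)] by blast
  fix s assume s: "s \<in> T \<and> (\<forall>t\<in>T. comparable s t) \<and> (\<forall>q\<in>T. (\<forall>t\<in>T. comparable q t) \<longrightarrow> prefix q s)"
  then have "prefix r s" using r(3) \<open>r \<in> T\<close> by blast
  moreover have "prefix s r" using split_node_maximal[OF r(1,2)] s by blast
  ultimately show "s = r" by simp
qed

lemma stem_split:
  assumes "T \<in> PT"
  shows "stem T @ [i] \<in> T" "t \<in> T \<Longrightarrow> comparable (stem T) t"
proof -
  from PT_split_node[OF assms] obtain r
    where r: "r @ [False] \<in> T" "r @ [True] \<in> T" "\<forall>t\<in>T. comparable r t" by (elim exE conjE)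
  have stem: "stem T = r" by (rule stem_eqI[OF assms r])
  show "stem T @ [i] \<in> T" using r(1,2) by (cases i) (simp_all add: stem)
  show "comparable (stem T) t" if "t \<in> T" using r(3) that by (simp add: stem)
qed

lemma stem_iff:
  assumes "T \<in> PT"
  shows "stem T = r \<longleftrightarrow> r @ [False] \<in> T \<and> r @ [True] \<in> T \<and> (\<forall>t\<in>T. comparable r t)"
  using stem_split[OF assms] stem_eqI[OF assms] by blast

text \<open>Expresses a lower bound on the stem by a bounded quantifier. It serves both to check the
  stem condition of \<open>spe\<close> and to define it over \<open>M\<close>.\<close>

lemma prefix_stem_iff:
  assumes "T \<in> PT"
  shows "prefix q (stem T) \<longleftrightarrow> (\<forall>t\<in>T. comparable q t)"
proof
  assume q: "prefix q (stem T)"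
  show "\<forall>t\<in>T. comparable q t"
  proof
    fix t assume "t \<in> T"
    then have "comparable (stem T) t" using stem_split[OF assms] by blast
    then show "comparable q t" using q by (meson prefix_order.trans prefix_same_cases)
  qed
next
  assume "\<forall>t\<in>T. comparable q t"
  then show "prefix q (stem T)" using split_node_maximal stem_split[OF assms] by blast
qed

lemma stem_mono:
  assumes "T \<in> PT" "T' \<in> PT" "T' \<subseteq> T" shows "prefix (stem T) (stem T')"
  unfolding prefix_stem_iff[OF assms(2)] using stem_split(2)[OF assms(1)] assms(3) by blast

section \<open>Building and modifying splitting systems\<close>

lemma ht_eqI: "dom \<phi> = {s. length s < n} \<Longrightarrow> ht \<phi> = n"
  unfolding ht_def
proof (rule the_equality)
  fix m assume "dom \<phi> = {s. length s < n}" "dom \<phi> = {s. length s < m}"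
  then have eq: "length (s :: str) < m \<longleftrightarrow> length s < n" for s by blast
  have "k < m \<longleftrightarrow> k < n" for k using eq[of "replicate k False"] by simp
  then show "m = n" by (metis linorder_neqE_nat less_irrefl)
qed

lemma spe_dom: "\<phi> \<in> spe P \<Longrightarrow> dom \<phi> = {s. length s < ht \<phi>}"
  unfolding spe_def using ht_eqI by blast

lemma spe_Some: "\<phi> \<in> spe P \<Longrightarrow> length s < ht \<phi> \<Longrightarrow> \<exists>T\<in>P. \<phi> s = Some T"
  using spe_dom[of \<phi> P] unfolding spe_def by (blast intro: ranI)

lemma spe_len: "\<phi> \<in> spe P \<Longrightarrow> \<phi> s = Some T \<Longrightarrow> length s < ht \<phi>"
  using spe_dom[of \<phi> P] by blast

lemma spe_in: "\<phi> \<in> spe P \<Longrightarrow> \<phi> s = Some T \<Longrightarrow> T \<in> P"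
  unfolding spe_def by (blast intro: ranI)

lemma spe_step:
  "\<phi> \<in> spe P \<Longrightarrow> \<phi> s = Some T \<Longrightarrow> \<phi> (s @ [i]) = Some T' \<Longrightarrow> T' \<subseteq> T \<and> prefix (stem T @ [i]) (stem T')"
  unfolding spe_def by blast

lemma speI:
  assumes "\<And>s. length s < n \<Longrightarrow> \<exists>T\<in>P. \<phi> s = Some T" "\<And>s. n \<le> length s \<Longrightarrow> \<phi> s = None"
    and "\<And>s i T T'. \<phi> s = Some T \<Longrightarrow> \<phi> (s @ [i]) = Some T' \<Longrightarrow> T' \<subseteq> T \<and> prefix (stem T @ [i]) (stem T')"
  shows "\<phi> \<in> spe P" "ht \<phi> = n"
proof -
  have dom: "dom \<phi> = {s. length s < n}"
    using assms(1,2) by (auto simp: dom_def) (metis linorder_not_less option.distinct(1))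
  then show "ht \<phi> = n" by (rule ht_eqI)
  have "T \<in> P" if "\<phi> s = Some T" for s T
    using that assms(1)[of s] assms(2)[of s] by (cases "length s < n") auto
  then have "ran \<phi> \<subseteq> P" by (auto simp: ran_def)
  then show "\<phi> \<in> spe P" unfolding spe_def using dom assms(3) by blast
qed

lemma empty_spe: "Map.empty \<in> spe P" "ht Map.empty = 0"
  by (rule speI[of 0]; simp)+

lemma single_spe:
  assumes "T \<in> P" shows "[[] \<mapsto> T] \<in> spe P" "ht [[] \<mapsto> T] = 1"
  by (rule speI[of 1]; use assms in \<open>auto split: if_splits\<close>)+

text \<open>Above a top tree \<open>T\<close> place its restrictions to the two successors of its
  stem. These successors are nodes of \<open>T\<close>, so the restrictions belong to
  \<open>P\<close>, and their stems extend them.\<close>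

lemma spe_grow1:
  assumes P: "perfect_tree_forcing P" and \<phi>: "\<phi> \<in> spe P"
  shows "\<exists>\<psi>\<in>spe P. ht \<psi> = Suc (ht \<phi>) \<and> (\<forall>s. length s < ht \<phi> \<longrightarrow> \<psi> s = \<phi> s)"
proof -
  \<comment> \<open>The empty string is on the new level only if the system was empty; its tree is
    then \<open>UNIV\<close>.\<close>
  define new where "new s = (if s = [] then UNIV else
    restr (the (\<phi> (butlast s))) (stem (the (\<phi> (butlast s))) @ [last s]))" for s
  define \<psi> where "\<psi> s = (if length s = ht \<phi> then Some (new s) else \<phi> s)" for s
  have PT: "T \<in> PT" if "T \<in> P" for T using that P unfolding perfect_tree_forcing_def by blast
  have restr: "restr T (stem T @ [i]) \<in> P" if "T \<in> P" for T i
    using that P stem_split(1)[OF PT[OF that]] unfolding perfect_tree_forcing_def by blast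
  have new: "new s \<in> P" if len: "length s = ht \<phi>" for s
  proof (cases s rule: rev_cases)
    case Nil
    then show ?thesis using P by (simp add: new_def perfect_tree_forcing_def)
  next
    case (snoc t i)
    then obtain T where "T \<in> P" "\<phi> t = Some T" using spe_Some[OF \<phi>, of t] len by auto
    then show ?thesis using snoc restr by (simp add: new_def)
  qed
  have none: "\<phi> s = None" if "ht \<phi> \<le> length s" for s
    using spe_len[OF \<phi>, of s] that by (metis linorder_not_less not_None_eq)
  have step: "T' \<subseteq> T \<and> prefix (stem T @ [i]) (stem T')"
    if "\<psi> s = Some T" "\<psi> (s @ [i]) = Some T'" for s i T T'
  proof (cases "length (s @ [i]) = ht \<phi>")
    case True
    then have T: "\<phi> s = Some T" "T' = restr T (stem T @ [i])"
      using that by (auto simp: \<psi>_def new_def)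
    then have "T \<in> P" using spe_in[OF \<phi>] by blast
    then have "T' \<in> PT" using T restr PT by blast
    then show ?thesis unfolding prefix_stem_iff[OF \<open>T' \<in> PT\<close>] using T by (auto simp: restr_def)
  next
    case False
    then have "\<phi> (s @ [i]) = Some T'" using that by (simp add: \<psi>_def)
    moreover from spe_len[OF \<phi> this] have "\<phi> s = Some T" using that by (simp add: \<psi>_def)
    ultimately show ?thesis using spe_step[OF \<phi>] by blast
  qed
  have some: "\<exists>T\<in>P. \<psi> s = Some T" if "length s < Suc (ht \<phi>)" for s
    using that new spe_Some[OF \<phi>, of s] by (cases "length s = ht \<phi>") (auto simp: \<psi>_def)
  have none': "\<psi> s = None" if "Suc (ht \<phi>) \<le> length s" for s
    using that none by (simp add: \<psi>_def)
  have "\<psi> \<in> spe P" "ht \<psi> = Suc (ht \<phi>)"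
    by (rule speI[where P=P], erule some, erule none', erule (1) step)+
  then show ?thesis
    by (intro bexI[of _ \<psi>]) (auto simp: \<psi>_def)
qed

lemma spe_grow:
  assumes P: "perfect_tree_forcing P" and \<phi>: "\<phi> \<in> spe P"
  shows "\<exists>\<psi>\<in>spe P. ht \<psi> = ht \<phi> + n \<and> (\<forall>s. length s < ht \<phi> \<longrightarrow> \<psi> s = \<phi> s)"
proof (induction n)
  case 0
  show ?case using \<phi> by (intro bexI[of _ \<phi>]) auto
next
  case (Suc n)
  then obtain \<psi> where \<psi>: "\<psi> \<in> spe P" "ht \<psi> = ht \<phi> + n" "\<forall>s. length s < ht \<phi> \<longrightarrow> \<psi> s = \<phi> s"
    by blast
  from spe_grow1[OF P \<psi>(1)] obtain \<chi> where
    "\<chi> \<in> spe P" "ht \<chi> = Suc (ht \<psi>)" "\<forall>s. length s < ht \<psi> \<longrightarrow> \<chi> s = \<psi> s" by blast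
  then show ?case using \<psi> by (intro bexI[of _ \<chi>]) auto
qed

text \<open>Nothing lies above the top level, and against the level below only inclusion and the
  stem condition matter; both survive shrinking, the latter by \<open>stem_mono\<close>.\<close>

lemma spe_replace_top:
  assumes P: "perfect_tree_forcing P" and \<phi>: "\<phi> \<in> spe P" "ht \<phi> = Suc h"
    and g: "\<And>t. length t = h \<Longrightarrow> g t \<in> P \<and> g t \<subseteq> the (\<phi> t)"
  defines "\<psi> \<equiv> \<lambda>t. if length t = h then Some (g t) else \<phi> t"
  shows "\<psi> \<in> spe P" "ht \<psi> = Suc h"
proof -
  have PT: "T \<in> PT" if "T \<in> P" for T using that P unfolding perfect_tree_forcing_def by blast
  have none: "\<phi> s = None" if "Suc h \<le> length s" for s
    using spe_len[OF \<phi>(1), of s] that \<phi>(2) by (metis linorder_not_less not_None_eq)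
  have step: "T' \<subseteq> T \<and> prefix (stem T @ [i]) (stem T')"
    if "\<psi> s = Some T" "\<psi> (s @ [i]) = Some T'" for s i T T'
  proof (cases "length (s @ [i]) = h")
    case True
    then have T: "\<phi> s = Some T" "T' = g (s @ [i])"
      using that by (auto simp: \<psi>_def)
    obtain T'' where T'': "\<phi> (s @ [i]) = Some T''" "T'' \<in> P"
      using spe_Some[OF \<phi>(1), of "s @ [i]"] True \<phi>(2) by auto
    have "T' \<in> P" "T' \<subseteq> T''" using g[OF True] T T'' by auto
    then have "prefix (stem T'') (stem T')" using stem_mono PT T'' by blast
    then show ?thesis using spe_step[OF \<phi>(1) T(1) T''(1)] \<open>T' \<subseteq> T''\<close> by (meson order_trans prefix_order.trans)
  next
    case False
    then have "\<phi> (s @ [i]) = Some T'" using that by (simp add: \<psi>_def)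
    moreover from spe_len[OF \<phi>(1) this] have "\<phi> s = Some T" using that \<phi>(2) by (simp add: \<psi>_def)
    ultimately show ?thesis using spe_step[OF \<phi>(1)] by blast
  qed
  have some: "\<exists>T\<in>P. \<psi> s = Some T" if "length s < Suc h" for s
    using that g spe_Some[OF \<phi>(1), of s] \<phi>(2) by (cases "length s = h") (auto simp: \<psi>_def)
  have none': "\<psi> s = None" if "Suc h \<le> length s" for s
    using that none by (simp add: \<psi>_def)
  show "\<psi> \<in> spe P" "ht \<psi> = Suc h"
    by (rule speI[where P=P], erule some, erule none', erule (1) step)+
qed

section \<open>Direct forcing\<close>

lemma forces_initial_mono: "forces_initial \<sigma> s c \<Longrightarrow> \<tau> \<le> \<sigma> \<Longrightarrow> forces_initial \<tau> s c"
  unfolding forces_initial_def forces_value_def by (meson order_trans)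

lemma forces_neq_mono: "forces_neq \<sigma> d c \<Longrightarrow> \<tau> \<le> \<sigma> \<Longrightarrow> forces_neq \<tau> d c"
  unfolding forces_neq_def by (meson forces_initial_mono)

text \<open>At the first difference \<rho> would lie below an element of either side of the name,
  and so would itself witness their compatibility.\<close>

lemma forces_initial_comparable:
  assumes c: "real_name P c" and \<rho>: "\<rho> \<in> finsupp P"
    and s: "forces_initial \<rho> s c" and t: "forces_initial \<rho> t c"
  shows "comparable s t"
proof (rule ccontr)
  assume "\<not> comparable s t"
  then have "s \<parallel> t" by blast
  from parallel_decomp[OF this]
  obtain p b bs b' bs' where p: "b \<noteq> b'" "s = p @ b # bs" "t = p @ b' # bs'"
    by (elim exE conjE)
  have "forces_value \<rho> c (length p) b" "forces_value \<rho> c (length p) b'"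
    using s t p unfolding forces_initial_def by (metis add_Suc_right length_Cons length_append less_add_Suc1 nth_append_length)+
  then have "forces_value \<rho> c (length p) False" "forces_value \<rho> c (length p) True"
    using p(1) by (cases b; cases b'; simp)+
  then obtain \<sigma> \<sigma>' where "\<sigma> \<in> c (length p) False" "\<rho> \<le> \<sigma>" "\<sigma>' \<in> c (length p) True" "\<rho> \<le> \<sigma>'"
    unfolding forces_value_def by blast
  moreover from this have "compat_in (finsupp P) \<sigma> \<sigma>'"
    unfolding compat_in_def using \<rho> by blast
  ultimately show False using c unfolding real_name_def by blast
qed

text \<open>Directly forcing the first difference into \<open>pi_name m\<close> fixes that bit on
  all long enough nodes of \<open>\<rho> m\<close>; the string forced into \<open>c\<close> has the
  other bit there.\<close>

lemma forces_neq_pi: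
  assumes "forces_neq \<rho> c (pi_name m)"
  shows "\<exists>t. forces_initial \<rho> t c \<and> t \<notin> \<rho> m"
proof -
  obtain s t where st: "s \<parallel> t" "forces_initial \<rho> s (pi_name m)" "forces_initial \<rho> t c"
    using assms unfolding forces_neq_def by blast
  from parallel_decomp[OF st(1)]
  obtain p b bs b' bs' where p: "b \<noteq> b'" "s = p @ b # bs" "t = p @ b' # bs'"
    by (elim exE conjE)
  have "forces_value \<rho> (pi_name m) (length p) b"
    using st(2) p unfolding forces_initial_def by (metis add_Suc_right length_Cons length_append less_add_Suc1 nth_append_length)
  then have "\<rho> m \<subseteq> {x. length p < length x \<longrightarrow> x ! length p = b}"
    unfolding forces_value_def pi_name_def by (simp add: le_fun_def) (drule spec[of _ m], simp)
  then have "t \<notin> \<rho> m" using p by auto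
  then show ?thesis using st(3) by blast
qed

text \<open>The strings forced into \<open>c\<close> are pairwise comparable, so the longer of two
  may be kept; leaving a tree is preserved by extension.\<close>

lemma forces_outside:
  assumes P: "perfect_tree_forcing P" and c: "real_name P c" and \<rho>: "\<rho> \<in> finsupp P"
    and "finite N" "\<And>m. m \<in> N \<Longrightarrow> forces_neq \<rho> c (pi_name m)"
  shows "\<exists>s. forces_initial \<rho> s c \<and> (\<forall>m\<in>N. s \<notin> \<rho> m)"
  using assms(4,5)
proof (induction N rule: finite_induct)
  case empty
  show ?case by (rule exI[of _ "[]"]) (simp add: forces_initial_def)
next
  case (insert m N)
  then obtain s where s: "forces_initial \<rho> s c" "\<forall>m\<in>N. s \<notin> \<rho> m" by blast
  obtain t where t: "forces_initial \<rho> t c" "t \<notin> \<rho> m" using forces_neq_pi insert by blast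
  have "range \<rho> \<subseteq> PT" using \<rho> P by (auto simp: finsupp_def perfect_tree_forcing_def)
  then have PT: "\<rho> m \<in> PT" for m by auto
  have up: "y \<notin> \<rho> m" if "x \<notin> \<rho> m" "prefix x y" for x y m
    using PT_tree[OF PT] that by metis
  from forces_initial_comparable[OF c \<rho> s(1) t(1)] show ?case
  proof
    assume "prefix s t"
    then have "\<forall>m\<in>insert m N. t \<notin> \<rho> m" using s(2) t(2) up by auto
    then show ?thesis using t(1) by (intro exI[of _ t] conjI)
  next
    assume "prefix t s"
    then have "\<forall>m\<in>insert m N. s \<notin> \<rho> m" using s(2) t(2) up by auto
    then show ?thesis using s(1) by (intro exI[of _ s] conjI)
  qed
qed

lemma shrink:
  assumes dense: "\<And>k. dense_in (finsupp P) {\<tau> \<in> finsupp P. forces_neq \<tau> c (pi_name k)}"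
    and "finite N" "\<rho>0 \<in> finsupp P"
  shows "\<exists>\<rho>\<in>finsupp P. \<rho> \<le> \<rho>0 \<and> (\<forall>m\<in>N. forces_neq \<rho> c (pi_name m))"
  using assms(2)
proof (induction N rule: finite_induct)
  case empty
  show ?case using assms(3) by blast
next
  case (insert m N)
  then obtain \<rho> where \<rho>: "\<rho> \<in> finsupp P" "\<rho> \<le> \<rho>0" "\<forall>m\<in>N. forces_neq \<rho> c (pi_name m)" by blast
  from dense[of m] \<rho>(1) obtain \<sigma> where "\<sigma> \<in> finsupp P" "forces_neq \<sigma> c (pi_name m)" "\<sigma> \<le> \<rho>"
    unfolding dense_in_def by blast
  then show ?case using \<rho> forces_neq_mono by (intro bexI[of _ \<sigma>]) (auto intro: order_trans)
qed

text \<open>Separates coordinates whose generic trees have equal or comparable indices, so that each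
  gets a node of its own.\<close>

lemma distinct_extensions:
  fixes sn :: "nat \<Rightarrow> str"
  assumes "\<And>n. n \<in> F \<Longrightarrow> n < R" "\<And>n. n \<in> F \<Longrightarrow> length (sn n) + R \<le> h (kn n)"
  shows "\<exists>w. (\<forall>n\<in>F. prefix (sn n) (w n) \<and> length (w n) = h (kn n)) \<and> inj_on (\<lambda>n. (kn n, w n)) F"
proof -
  \<comment> \<open>The last \<open>R\<close> bits are the indicator of \<open>n\<close>, which
    identifies \<open>n\<close> because \<open>n < R\<close>; the zeros in between pad to the
    required length.\<close>
  define w where "w n = (sn n @ replicate (h (kn n) - length (sn n) - R) False) @ map (\<lambda>j. j = n) [0..<R]" for n
  have 1: "prefix (sn n) (w n)" "length (w n) = h (kn n)" if "n \<in> F" for n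
    using assms(2)[OF that] by (auto simp: w_def)
  have "inj_on (\<lambda>n. (kn n, w n)) F"
  proof (rule inj_onI)
    fix n m assume nm: "n \<in> F" "m \<in> F" "(kn n, w n) = (kn m, w m)"
    then have "w n = w m" by simp
    then have "map (\<lambda>j. j = n) [0..<R] = map (\<lambda>j. j = m) [0..<R]"
      unfolding w_def by (subst (asm) append_eq_append_conv) auto
    then have "map (\<lambda>j. j = n) [0..<R] ! n = map (\<lambda>j. j = m) [0..<R] ! n" by (rule arg_cong)
    then show "n = m" using assms(1)[OF nm(1)] by simp
  qed
  then show ?thesis using 1 by blast
qed

text \<open>Prescribed positions keep their coordinate in \<open>F2\<close>; all others are numbered
  from a bound \<open>B\<close> above \<open>F1\<close> and \<open>F2\<close> onwards, so no clash
  occurs.\<close>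

lemma extend_index:
  fixes W :: "('a::countable) set" and F1 F2 :: "nat set"
  assumes "finite F1" "finite F2" "F1 \<inter> F2 = {}" "inj_on w F2"
  shows "\<exists>idx. inj_on idx W \<and> (\<forall>n\<in>F2. idx (w n) = n) \<and> idx ` W \<inter> F1 = {}"
proof -
  obtain B where B: "\<And>n. n \<in> F1 \<union> F2 \<Longrightarrow> n < B"
    using finite_nat_set_iff_bounded[of "F1 \<union> F2"] assms(1,2) by blast
  define idx where "idx x = (if x \<in> w ` F2 then inv_into F2 w x else B + to_nat x)" for x
  have "idx x \<in> F2" if "x \<in> w ` F2" for x
    using that by (simp add: idx_def inv_into_into)
  moreover have "B \<le> idx x" if "x \<notin> w ` F2" for x using that by (simp add: idx_def)
  ultimately have 1: "x \<in> w ` F2 \<longleftrightarrow> idx x < B" for x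
    using B by (meson UnI2 linorder_not_less)
  have "inj_on idx W"
  proof (rule inj_onI)
    fix x y assume eq: "idx x = idx y"
    show "x = y"
    proof (cases "x \<in> w ` F2")
      case True
      then have "y \<in> w ` F2" using 1 eq by simp
      with True show ?thesis using eq by (simp add: idx_def) (metis f_inv_into_f)
    next
      case False
      then have "y \<notin> w ` F2" using 1 eq by simp
      with False show ?thesis using eq by (simp add: idx_def)
    qed
  qed
  moreover have "idx (w n) = n" if "n \<in> F2" for n
    using that assms(4) by (simp add: idx_def)
  moreover have "idx x \<notin> F1" for x
  proof (cases "x \<in> w ` F2")
    case True
    then show ?thesis using assms(3) by (auto simp: idx_def inv_into_into)
  next
    case False
    then show ?thesis using B by (auto simp: idx_def)
  qed
  ultimately show ?thesis by blast
qed

text \<open>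
  Here \<open>F1\<close> stands for the coordinates with \<open>u n \<in> P\<close> (and \<open>a\<close> for \<open>u\<close>), \<open>F2\<close> for those where \<open>u n\<close> is
  the generic tree with indices \<open>kn n\<close> and \<open>sn n\<close>, and \<open>U\<close> has indices \<open>K\<close> and \<open>s0\<close>.
\<close>

definition carries_witness :: "tree set \<Rightarrow> real_sys \<Rightarrow> nat set \<Rightarrow> cond \<Rightarrow> nat set \<Rightarrow> (nat \<Rightarrow> nat) \<Rightarrow> (nat \<Rightarrow> str) \<Rightarrow>
    nat \<Rightarrow> str \<Rightarrow> gsys \<Rightarrow> bool" where
  "carries_witness P c F1 a F2 kn sn K s0 \<Phi> \<longleftrightarrow> (\<exists>\<tau>\<in>finsupp P. \<exists>s. forces_initial \<tau> s c \<and>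
     (\<forall>n. \<tau> n = UNIV \<or> (\<exists>k t. \<Phi> k t = Some (\<tau> n))) \<and>
     (\<forall>n\<in>F1. \<tau> n \<subseteq> a n) \<and>
     (\<forall>n\<in>F2. \<exists>t. prefix (sn n) t \<and> \<Phi> (kn n) t = Some (\<tau> n)) \<and>
     (\<exists>h>length s0. \<forall>t. length t = h \<longrightarrow> (\<exists>T. \<Phi> K t = Some T \<and> s \<notin> T)))"

lemma carries_witness_dense:
  assumes P: "perfect_tree_forcing P" and c: "real_name P c"
    and dense: "\<And>k. dense_in (finsupp P) {\<tau> \<in> finsupp P. forces_neq \<tau> c (pi_name k)}"
    and F: "finite F1" "finite F2" "F1 \<inter> F2 = {}" and a: "\<And>n. n \<in> F1 \<Longrightarrow> a n \<in> P"
    and \<Psi>: "\<Psi> \<in> spg P"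
  shows "\<exists>\<Phi>\<in>spg P. spg_le \<Psi> \<Phi> \<and> carries_witness P c F1 a F2 kn sn K s0 \<Phi>"
proof -
  have spe: "\<Psi> k \<in> spe P" for k using \<Psi> unfolding spg_def by blast
  have UNIV: "UNIV \<in> P" using P unfolding perfect_tree_forcing_def by blast
  define A where "A = insert K (kn ` F2)"
  have finA: "finite A" using F by (simp add: A_def)
  obtain R where R: "\<And>n. n \<in> F2 \<Longrightarrow> n < R"
    using finite_nat_set_iff_bounded[of F2] F by auto
  obtain L where L: "\<And>n. n \<in> F2 \<Longrightarrow> length (sn n) < L"
    using finite_nat_set_iff_bounded[of "(\<lambda>n. length (sn n)) ` F2"] F by auto
  \<comment> \<open>\<open>Suc (length s0)\<close> puts the top level of system \<open>K\<close>
    strictly above \<open>s0\<close>, \<open>L\<close> bounds the lengths of the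
    \<open>sn n\<close>, and \<open>R\<close> leaves room for the indicator bits.\<close>
  define N where "N = Suc (length s0) + L + R"
  \<comment> \<open>\<open>h k\<close> will be the index of the top level, the height being
    \<open>Suc (h k)\<close>. It is at least the old height, so replacing that level leaves
    \<open>\<Psi> k\<close> intact.\<close>
  define h where "h k = ht (\<Psi> k) + N" for k
  have "\<exists>\<psi>\<in>spe P. ht \<psi> = Suc (h k) \<and> (\<forall>s. length s < ht (\<Psi> k) \<longrightarrow> \<psi> s = \<Psi> k s)" for k
    using spe_grow[OF P spe[of k], of "Suc N"] by (simp add: h_def)
  then obtain \<psi> where \<psi>: "\<And>k. \<psi> k \<in> spe P" "\<And>k. ht (\<psi> k) = Suc (h k)"
    "\<And>k s. length s < ht (\<Psi> k) \<Longrightarrow> \<psi> k s = \<Psi> k s" by metis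
  have "length (sn n) + R \<le> h (kn n)" if "n \<in> F2" for n
    using L[OF that] by (simp add: h_def N_def)
  then obtain w where w: "\<And>n. n \<in> F2 \<Longrightarrow> prefix (sn n) (w n) \<and> length (w n) = h (kn n)"
    and injw: "inj_on (\<lambda>n. (kn n, w n)) F2"
    using distinct_extensions[of F2 R sn h kn] R by blast
  define W where "W = (SIGMA k:A. {t :: str. length t = h k})"
  have finW: "finite W"
    unfolding W_def using finA finite_lists_length_eq[of "UNIV :: bool set"] by auto
  obtain idx where idx: "inj_on idx W" "\<And>n. n \<in> F2 \<Longrightarrow> idx (kn n, w n) = n" "idx ` W \<inter> F1 = {}"
    using extend_index[OF F injw, of W] by blast
  define Top where "Top = (\<lambda>(k, t). the (\<psi> k t))"
  have Top: "Top x \<in> P" if "x \<in> W" for x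
    using that spe_Some[OF \<psi>(1), of "snd x" "fst x"] \<psi>(2) by (force simp: W_def Top_def)
  \<comment> \<open>A coordinate in \<open>F2\<close> falls under the second case, since
    \<open>idx (kn n, w n) = n\<close>; there the bound is a tree of the system and not
    \<open>u n\<close>.\<close>
  define \<rho>0 where "\<rho>0 n = (if n \<in> F1 then a n else if n \<in> idx ` W then Top (inv_into W idx n) else UNIV)" for n
  have "{n. \<rho>0 n \<noteq> UNIV} \<subseteq> F1 \<union> idx ` W" by (auto simp: \<rho>0_def)
  then have "finite {n. \<rho>0 n \<noteq> UNIV}" by (rule finite_subset) (use F finW in simp)
  moreover have "\<rho>0 n \<in> P" for n
    using a Top inv_into_into[of n idx W] UNIV by (simp add: \<rho>0_def)
  ultimately have \<rho>0: "\<rho>0 \<in> finsupp P" by (auto simp: finsupp_def)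
  have \<rho>0_idx: "\<rho>0 (idx x) = Top x" if "x \<in> W" for x
    using that idx(1,3) by (auto simp: \<rho>0_def)
  \<comment> \<open>Only positions of system \<open>K\<close> matter for avoiding \<open>U\<close>;
    at the other coordinates the name need not be separated from the generic real.\<close>
  define WK where "WK = idx ` {x \<in> W. fst x = K}"
  have "finite WK" using finW by (simp add: WK_def)
  from shrink[OF dense this \<rho>0] obtain \<rho> where
    \<rho>: "\<rho> \<in> finsupp P" "\<rho> \<le> \<rho>0" "\<forall>m\<in>WK. forces_neq \<rho> c (pi_name m)" by blast
  have \<rho>P: "\<rho> n \<in> P" for n using \<rho>(1) unfolding finsupp_def by blast
  from forces_outside[OF P c \<rho>(1) \<open>finite WK\<close>] \<rho>(3) obtain s where
    s: "forces_initial \<rho> s c" "\<forall>m\<in>WK. s \<notin> \<rho> m" by blast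
  have "finite ({k. \<Psi> k \<noteq> Map.empty} \<union> A)" using \<Psi> finA by (simp add: spg_def)
  then obtain B where B: "\<And>k. k \<in> {k. \<Psi> k \<noteq> Map.empty} \<union> A \<Longrightarrow> k < B"
    using finite_nat_set_iff_bounded by meson
  \<comment> \<open>The proper components of \<rho> not attached to a top position, which includes
    those in \<open>F1\<close>. Component \<open>n\<close> goes to the root of system
    \<open>B + n\<close>, which is empty in \<Psi> and lies outside \<open>A\<close>.\<close>
  define S where "S = {n. \<rho> n \<noteq> UNIV} - idx ` W"
  have finS: "finite S" using \<rho>(1) by (simp add: S_def finsupp_def)
  define \<Phi> where "\<Phi> k = (if k \<in> A then (\<lambda>t. if length t = h k then Some (\<rho> (idx (k, t))) else \<psi> k t)
      else if B \<le> k \<and> k - B \<in> S then [[] \<mapsto> \<rho> (k - B)] else \<Psi> k)" for k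
  have \<Phi>A: "\<Phi> k \<in> spe P \<and> ht (\<Phi> k) = Suc (h k)" if "k \<in> A" for k
  proof -
    have "\<rho> (idx (k, t)) \<in> P \<and> \<rho> (idx (k, t)) \<subseteq> the (\<psi> k t)" if "length t = h k" for t
      using \<rho>(2) \<rho>0_idx[of "(k, t)"] that \<open>k \<in> A\<close> \<rho>P by (auto simp: W_def Top_def le_fun_def)
    from spe_replace_top[OF P \<psi>(1,2), OF this] show ?thesis using that by (simp add: \<Phi>_def)
  qed
  have \<Phi>B: "\<Phi> (B + n) = [[] \<mapsto> \<rho> n]" if "n \<in> S" for n
    using that B[of "B + n"] by (auto simp: \<Phi>_def)
  have "\<Phi> k \<in> spe P" for k
    using \<Phi>A[of k] single_spe(1)[OF \<rho>P] spe by (cases "k \<in> A") (auto simp: \<Phi>_def)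
  moreover have "{k. \<Phi> k \<noteq> Map.empty} \<subseteq> {..<B} \<union> (+) B ` S"
  proof
    fix k assume k: "k \<in> {k. \<Phi> k \<noteq> Map.empty}"
    show "k \<in> {..<B} \<union> (+) B ` S"
    proof (cases "k < B")
      case False
      then have "k \<notin> A" "\<Psi> k = Map.empty" using B[of k] by auto
      then have "k - B \<in> S" using k by (auto simp: \<Phi>_def split: if_splits)
      then show ?thesis using False by (intro UnI2 image_eqI[of _ _ "k - B"]) auto
    qed simp
  qed
  then have "finite {k. \<Phi> k \<noteq> Map.empty}" by (rule finite_subset) (use finS in simp)
  ultimately have \<Phi>: "\<Phi> \<in> spg P" by (auto simp: spg_def)
  have "spe_le (\<Psi> k) (\<Phi> k)" for k
  proof (cases "k \<in> A")
    case True
    then have "\<Phi> k s = \<Psi> k s" if "length s < ht (\<Psi> k)" for s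
      using that \<psi>(3)[OF that] by (simp add: \<Phi>_def h_def N_def)
    then show ?thesis using \<Phi>A[OF True] by (simp add: spe_le_def h_def)
  next
    case False
    show ?thesis
    proof (cases "B \<le> k \<and> k - B \<in> S")
      case True
      then have "\<Psi> k = Map.empty" using B[of k] by force
      then show ?thesis by (simp add: spe_le_def empty_spe)
    next
      case False
      then show ?thesis using \<open>k \<notin> A\<close> by (auto simp: \<Phi>_def spe_le_def)
    qed
  qed
  then have le: "spg_le \<Psi> \<Phi>" by (simp add: spg_le_def)
  have \<Phi>W: "\<Phi> k t = Some (\<rho> (idx (k, t)))" if "(k, t) \<in> W" for k t
    using that by (auto simp: \<Phi>_def W_def)
  have "carries_witness P c F1 a F2 kn sn K s0 \<Phi>"
    unfolding carries_witness_def
  proof (rule bexI[of _ \<rho>], rule exI[of _ s], intro conjI allI ballI)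
    fix n
    show "\<rho> n = UNIV \<or> (\<exists>k t. \<Phi> k t = Some (\<rho> n))"
    proof (cases "n \<in> idx ` W")
      case True
      then show ?thesis using \<Phi>W by force
    next
      case False
      show ?thesis
      proof (cases "\<rho> n = UNIV")
        case False
        then have "n \<in> S" using \<open>n \<notin> idx ` W\<close> by (simp add: S_def)
        then have "\<Phi> (B + n) [] = Some (\<rho> n)" using \<Phi>B by simp
        then show ?thesis by blast
      qed simp
    qed
  next
    fix n assume "n \<in> F1"
    then show "\<rho> n \<subseteq> a n" using \<rho>(2)[unfolded le_fun_def, THEN spec[of _ n]] by (simp add: \<rho>0_def)
  next
    fix n assume n: "n \<in> F2"
    then have "(kn n, w n) \<in> W" using w by (auto simp: W_def A_def)
    then have "\<Phi> (kn n) (w n) = Some (\<rho> n)" using \<Phi>W idx(2)[OF n] by simp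
    then show "\<exists>t. prefix (sn n) t \<and> \<Phi> (kn n) t = Some (\<rho> n)" using w[OF n] by blast
  next
    show "\<exists>h>length s0. \<forall>t. length t = h \<longrightarrow> (\<exists>T. \<Phi> K t = Some T \<and> s \<notin> T)"
    proof (intro exI[of _ "h K"] conjI allI impI)
      fix t :: str assume "length t = h K"
      then have t: "(K, t) \<in> W" by (simp add: W_def A_def)
      then have "idx (K, t) \<in> WK" by (force simp: WK_def)
      then show "\<exists>T. \<Phi> K t = Some T \<and> s \<notin> T" using \<Phi>W[OF t] s(2) by blast
    qed (simp add: h_def N_def)
  qed (use \<rho> s in auto)
  then show ?thesis using \<Phi> le by blast
qed

section \<open>The dense set in the model and the generic trees\<close>

context ctm
begin

lemma spe_finite_dom: "\<phi> \<in> spe P \<Longrightarrow> finite (dom \<phi>)"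
  using spe_dom[of \<phi> P] finite_lists_length_le[of "UNIV :: bool set" "ht \<phi>"]
  by (auto intro: finite_subset[rotated])

lemma set_in_spe:
  assumes P: "perfect_tree_forcing P" and PM: "set_in (htree ` P) M"
  shows "set_in (htsys ` spe P) M"
proof -
  define PC where "PC = hset (htree ` P)"
  have PC: "PC \<in> M" "elts PC = htree ` P"
    using PM by (simp_all add: PC_def set_inD elts_set_in)
  \<comment> \<open>The elements of \<open>n\<close> are the smaller naturals, so the right-hand
    side says that \<open>s\<close> is shorter than \<open>n\<close>.\<close>
  define Q1 where "Q1 \<phi> \<longleftrightarrow> (\<exists>n\<in>elts om. \<forall>s\<in>elts hstrs.
      (\<exists>T\<in>elts PC. hpair s T \<in> elts \<phi>) \<longleftrightarrow> (\<exists>m\<in>elts n. haslen s m))" for \<phi>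
  \<comment> \<open>The stem of \<open>T'\<close> is not named: that it extends \<open>r'\<close> is
    expressed by comparability of \<open>r'\<close> with all nodes of \<open>T'\<close>.\<close>
  define Q2 where "Q2 \<phi> \<longleftrightarrow> (\<forall>s\<in>elts hstrs. \<forall>q\<in>elts hstrs. \<forall>i\<in>elts hbits. \<forall>T\<in>elts PC. \<forall>T'\<in>elts PC.
      happend s i q \<and> hpair s T \<in> elts \<phi> \<and> hpair q T' \<in> elts \<phi> \<longrightarrow>
      elts T' \<subseteq> elts T \<and> (\<exists>r\<in>elts hstrs. \<exists>r'\<in>elts hstrs. hstem r T \<and> happend r i r' \<and>
        (\<forall>t\<in>elts T'. elts r' \<subseteq> elts t \<or> elts t \<subseteq> elts r')))" for \<phi>
  have "definable (\<lambda>e. Q1 (e 0))"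
    unfolding Q1_def
    by (intro dfn_intros dfn_haslen tm_intros tm_const omega hstrs_M PC)
  moreover have "definable (\<lambda>e. Q2 (e 0))"
    unfolding Q2_def
    by (intro dfn_intros dfn_happend dfn_hstem tm_intros tm_const hbits_M hstrs_M PC)
  ultimately have "definable (\<lambda>e. Q1 (e 0) \<and> Q2 (e 0))" by (rule dfn_conj)
  from set_in_sep[OF set_in_finite_maps[OF PM] this]
  have "set_in {x \<in> htsys ` {\<phi>. finite (dom \<phi>) \<and> ran \<phi> \<subseteq> P}. Q1 x \<and> Q2 x} M" .
  moreover have Q: "Q1 (htsys \<phi>) \<and> Q2 (htsys \<phi>) \<longleftrightarrow> \<phi> \<in> spe P" if ran: "ran \<phi> \<subseteq> P" for \<phi>
  proof -
    have inP: "T \<in> P" if "\<phi> s = Some T" for s T using ran ranI[of \<phi> s T] that by blast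
    have PT: "T \<in> PT" if "T \<in> P" for T using that P unfolding perfect_tree_forcing_def by blast
    have "Q1 (htsys \<phi>) \<longleftrightarrow> (\<exists>n. \<forall>s. (\<exists>T\<in>P. \<phi> s = Some T) \<longleftrightarrow> length s < n)"
      unfolding Q1_def by (simp add: PC hnat_eq)
    also have "\<dots> \<longleftrightarrow> (\<exists>n. dom \<phi> = {s. length s < n})"
    proof -
      have "(\<exists>T\<in>P. \<phi> s = Some T) \<longleftrightarrow> s \<in> dom \<phi>" for s using inP by blast
      then show ?thesis by (simp add: set_eq_iff)
    qed
    finally have 1: "Q1 (htsys \<phi>) \<longleftrightarrow> (\<exists>n. dom \<phi> = {s. length s < n})" .
    have "Q2 (htsys \<phi>) \<longleftrightarrow> (\<forall>s i. \<forall>T\<in>P. \<forall>T'\<in>P. \<phi> s = Some T \<and> \<phi> (s @ [i]) = Some T' \<longrightarrow>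
       T' \<subseteq> T \<and> (\<exists>r. (\<forall>t\<in>T. comparable r t) \<and> r @ [False] \<in> T \<and> r @ [True] \<in> T \<and> (\<forall>t\<in>T'. comparable (r @ [i]) t)))"
      unfolding Q2_def by (simp add: PC) blast
    also have "\<dots> \<longleftrightarrow> (\<forall>s i. \<forall>T\<in>P. \<forall>T'\<in>P. \<phi> s = Some T \<and> \<phi> (s @ [i]) = Some T' \<longrightarrow>
       T' \<subseteq> T \<and> prefix (stem T @ [i]) (stem T'))"
    proof -
      have "(\<exists>r. (\<forall>t\<in>T. comparable r t) \<and> r @ [False] \<in> T \<and> r @ [True] \<in> T \<and> (\<forall>t\<in>T'. comparable (r @ [i]) t)) \<longleftrightarrow>
          prefix (stem T @ [i]) (stem T')" if "T \<in> P" "T' \<in> P" for T T' i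
      proof -
        have "(\<exists>r. (\<forall>t\<in>T. comparable r t) \<and> r @ [False] \<in> T \<and> r @ [True] \<in> T \<and> (\<forall>t\<in>T'. comparable (r @ [i]) t)) \<longleftrightarrow>
            (\<exists>r. stem T = r \<and> (\<forall>t\<in>T'. comparable (r @ [i]) t))"
          unfolding stem_iff[OF PT[OF that(1)]] by blast
        then show ?thesis unfolding prefix_stem_iff[OF PT[OF that(2)]] by simp
      qed
      then show ?thesis by simp
    qed
    also have "\<dots> \<longleftrightarrow> (\<forall>s i T T'. \<phi> s = Some T \<and> \<phi> (s @ [i]) = Some T' \<longrightarrow>
       T' \<subseteq> T \<and> prefix (stem T @ [i]) (stem T'))"
      using inP by blast
    finally show ?thesis unfolding spe_def mem_Collect_eq using 1 ran by simp
  qed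
  have ran: "ran \<phi> \<subseteq> P" if "\<phi> \<in> spe P" for \<phi>
    using that by (simp add: spe_def)
  have "{x \<in> htsys ` {\<phi>. finite (dom \<phi>) \<and> ran \<phi> \<subseteq> P}. Q1 x \<and> Q2 x} = htsys ` spe P"
    using spe_finite_dom[of _ P] Q ran by (auto intro!: imageI)
  ultimately show ?thesis by simp
qed

text \<open>The condition \<tau> ranges over a set in \<open>M\<close>, and \<open>c\<close> is
  available through its code. The functions \<open>a\<close>, \<open>kn\<close>, \<open>sn\<close>
  are not assumed to be in \<open>M\<close>; their values on the finite sets \<open>F1\<close> and
  \<open>F2\<close> enter as finitely many constants.\<close>

lemma set_in_carries_witness:
  assumes P: "perfect_tree_forcing P" and PM: "set_in (htree ` P) M"
    and c: "real_name P c" "real_sys_in c M"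
    and F: "finite F1" "finite F2" and a: "\<And>n. n \<in> F1 \<Longrightarrow> a n \<in> P"
  shows "set_in (hgsys ` {\<Phi> \<in> spg P. carries_witness P c F1 a F2 kn sn K s0 \<Phi>}) M"
proof -
  define PC where "PC = hset (htree ` P)"
  have PC: "PC \<in> M" "elts PC = htree ` P"
    using PM by (simp_all add: PC_def set_inD elts_set_in)
  define SPE where "SPE = hset (htsys ` spe P)"
  have SPE: "SPE \<in> M" "elts SPE = htsys ` spe P"
    using set_in_spe[OF P PM] by (simp_all add: SPE_def set_inD elts_set_in)
  have UNIV: "UNIV \<in> P" using P unfolding perfect_tree_forcing_def by blast
  have spg: "set_in (hgsys ` spg P) M"
    using set_in_hfun[OF set_in_spe[OF P PM] empty_spe(1)] by (simp add: hgsys_hfun spg_def)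
  define FS where "FS = hset (hcond ` finsupp P)"
  have "set_in (hcond ` finsupp P) M"
    using set_in_hfun[OF PM UNIV] by (simp add: hcond_hfun finsupp_def)
  then have FS: "FS \<in> M" "elts FS = hcond ` finsupp P"
    by (simp_all add: FS_def set_inD elts_set_in)
  define CS where "CS = {hpair (hpair (hnat n) (hbit i)) (hset (hcond ` c n i)) | n i. True}"
  have CS: "set_in CS M" and cc: "countable (c n i)" for n i
    using c(2) unfolding real_sys_in_def CS_def by blast+
  define CC where "CC = hset CS"
  have CC: "CC \<in> M" "elts CC = CS"
    using CS by (simp_all add: CC_def set_inD elts_set_in)
  have treeM: "htree T \<in> M" if "T \<in> P" for T using set_in_mem[OF PM] that by blast
  \<comment> \<open>\<open>S\<close> decodes \<open>c n i\<close> from the graph of the name; the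
    innermost clause is the componentwise order between \<tau> and \<sigma>.\<close>
  define Q1 where "Q1 \<tau> s \<longleftrightarrow> (\<forall>n\<in>elts om. \<forall>i\<in>elts hbits. hpair n i \<in> elts s \<longrightarrow>
     (\<exists>S\<in>M. hpair (hpair n i) S \<in> elts CC \<and> (\<exists>\<sigma>\<in>elts S. \<forall>m\<in>elts om. \<forall>T\<in>elts PC. \<forall>T'\<in>elts PC.
        hpair m T \<in> elts \<tau> \<and> hpair m T' \<in> elts \<sigma> \<longrightarrow> elts T \<subseteq> elts T')))" for \<tau> s
  define Q2 where "Q2 \<tau> x \<longleftrightarrow> (\<forall>n\<in>elts om. hpair n (htree UNIV) \<in> elts \<tau> \<or>
     (\<exists>k\<in>elts om. \<exists>\<phi>\<in>elts SPE. \<exists>t\<in>elts hstrs. \<exists>T\<in>elts PC.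
        hpair n T \<in> elts \<tau> \<and> hpair k \<phi> \<in> elts x \<and> hpair t T \<in> elts \<phi>))" for \<tau> x
  define Q3 where "Q3 \<tau> \<longleftrightarrow> (\<forall>n\<in>F1. \<forall>T\<in>elts PC. hpair (hnat n) T \<in> elts \<tau> \<longrightarrow> elts T \<subseteq> elts (htree (a n)))" for \<tau>
  define Q4 where "Q4 \<tau> x \<longleftrightarrow> (\<forall>n\<in>F2. \<exists>t\<in>elts hstrs. \<exists>T\<in>elts PC. \<exists>\<phi>\<in>elts SPE.
     elts (hstr (sn n)) \<subseteq> elts t \<and> hpair (hnat (kn n)) \<phi> \<in> elts x \<and> hpair t T \<in> elts \<phi> \<and>
     hpair (hnat n) T \<in> elts \<tau>)" for \<tau> x
  define Q5 where "Q5 s x \<longleftrightarrow> (\<exists>h\<in>elts om. hnat (length s0) \<in> elts h \<and> (\<exists>\<phi>\<in>elts SPE. hpair (hnat K) \<phi> \<in> elts x \<and>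
     (\<forall>t\<in>elts hstrs. haslen t h \<longrightarrow> (\<exists>T\<in>elts PC. hpair t T \<in> elts \<phi> \<and> s \<notin> elts T))))" for s x
  define Q where "Q x \<longleftrightarrow> (\<exists>\<tau>\<in>elts FS. \<exists>s\<in>elts hstrs. Q1 \<tau> s \<and> Q2 \<tau> x \<and> Q3 \<tau> \<and> Q4 \<tau> x \<and> Q5 s x)" for x
  have d1: "definable (\<lambda>e. Q1 (e i) (e j))" for i j
    unfolding Q1_def by (intro dfn_intros tm_intros tm_const omega hbits_M PC(1) CC(1))
  have d2: "definable (\<lambda>e. Q2 (e i) (e j))" for i j
    unfolding Q2_def by (intro dfn_intros tm_intros tm_const omega hstrs_M PC(1) SPE(1) treeM UNIV)
  have d3: "definable (\<lambda>e. Q3 (e i))" for i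
    unfolding Q3_def
  proof (rule dfn_finite[OF F(1)])
    fix n assume "n \<in> F1"
    then have "htree (a n) \<in> M" by (intro treeM a)
    then show "definable (\<lambda>e. \<forall>T\<in>elts PC. hpair (hnat n) T \<in> elts (e i) \<longrightarrow> elts T \<subseteq> elts (htree (a n)))"
      by (intro dfn_intros tm_intros tm_const PC(1) hnat_M)
  qed
  have d4: "definable (\<lambda>e. Q4 (e i) (e j))" for i j
    unfolding Q4_def
    by (rule dfn_finite[OF F(2)]) (intro dfn_intros tm_intros tm_const PC(1) SPE(1) hstrs_M hnat_M hstr_M)
  have d5: "definable (\<lambda>e. Q5 (e i) (e j))" for i j
    unfolding Q5_def
    by (intro dfn_intros dfn_haslen tm_intros tm_const omega PC(1) SPE(1) hstrs_M hnat_M)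
  have "definable (\<lambda>e. Q (e 0))"
    unfolding Q_def by (intro dfn_intros d1 d2 d3 d4 d5 tm_const hstrs_M FS)
  from set_in_sep[OF spg this]
  have "set_in {x \<in> hgsys ` spg P. Q x} M" .
  moreover have "Q (hgsys \<Phi>) \<longleftrightarrow> carries_witness P c F1 a F2 kn sn K s0 \<Phi>" if \<Phi>: "\<Phi> \<in> spg P" for \<Phi>
  proof -
    have spe: "\<Phi> k \<in> spe P" for k using \<Phi> unfolding spg_def by auto
    have inP: "T \<in> P" if "\<Phi> k t = Some T" for k t T using spe_in[OF spe that] .
    have Q1: "Q1 (hcond \<tau>) (hstr s) \<longleftrightarrow> forces_initial \<tau> s c" if \<tau>: "\<tau> \<in> finsupp P" for \<tau> s
    proof -
      have le: "(\<forall>m. \<forall>T\<in>P. \<forall>T'\<in>P. \<tau> m = T \<and> \<sigma> m = T' \<longrightarrow> T \<subseteq> T') \<longleftrightarrow> \<tau> \<le> \<sigma>"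
        if "\<sigma> \<in> finsupp P" for \<sigma>
        using that \<tau> by (auto simp: finsupp_def le_fun_def)
      have sub: "c n i \<subseteq> finsupp P" for n i using c(1) unfolding real_name_def by blast
      have "(\<exists>S\<in>M. hpair (hpair (hnat n) (hbit i)) S \<in> elts CC \<and> R S) \<longleftrightarrow> R (hset (hcond ` c n i))" for n i R
      proof -
        have "hpair (hpair (hnat n) (hbit i)) S \<in> elts CC \<longleftrightarrow> S = hset (hcond ` c n i)" for S
          unfolding CC(2) CS_def by auto
        moreover have "hset (hcond ` c n i) \<in> M"
          using hpair_MD set_in_mem[OF CS] unfolding CS_def by blast
        ultimately show ?thesis by simp
      qed
      then have "Q1 (hcond \<tau>) (hstr s) \<longleftrightarrow> (\<forall>n i. n < length s \<and> s ! n = i \<longrightarrow>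
        (\<exists>\<sigma>\<in>c n i. \<forall>m. \<forall>T\<in>P. \<forall>T'\<in>P. \<tau> m = T \<and> \<sigma> m = T' \<longrightarrow> T \<subseteq> T'))"
        unfolding Q1_def by (simp add: PC cc)
      also have "\<dots> \<longleftrightarrow> (\<forall>n i. n < length s \<and> s ! n = i \<longrightarrow> (\<exists>\<sigma>\<in>c n i. \<tau> \<le> \<sigma>))"
      proof -
        have "(\<exists>\<sigma>\<in>c n i. \<forall>m. \<forall>T\<in>P. \<forall>T'\<in>P. \<tau> m = T \<and> \<sigma> m = T' \<longrightarrow> T \<subseteq> T') \<longleftrightarrow> (\<exists>\<sigma>\<in>c n i. \<tau> \<le> \<sigma>)" for n i
          by (rule bex_cong[OF refl], rule le, erule subsetD[OF sub])
        then show ?thesis by (simp only:)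
      qed
      also have "\<dots> \<longleftrightarrow> forces_initial \<tau> s c"
        unfolding forces_initial_def forces_value_def by blast
      finally show ?thesis .
    qed
    have tau: "\<tau> n \<in> P" if "\<tau> \<in> finsupp P" for \<tau> n using that by (auto simp: finsupp_def)
    have Q2: "Q2 (hcond \<tau>) (hgsys \<Phi>) \<longleftrightarrow> (\<forall>n. \<tau> n = UNIV \<or> (\<exists>k t. \<Phi> k t = Some (\<tau> n)))"
      if "\<tau> \<in> finsupp P" for \<tau>
      unfolding Q2_def using tau[OF that] spe by (simp add: PC SPE)
    have Q3: "Q3 (hcond \<tau>) \<longleftrightarrow> (\<forall>n\<in>F1. \<tau> n \<subseteq> a n)" if "\<tau> \<in> finsupp P" for \<tau>
      unfolding Q3_def using tau[OF that] by (simp add: PC)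
    have Q4: "Q4 (hcond \<tau>) (hgsys \<Phi>) \<longleftrightarrow> (\<forall>n\<in>F2. \<exists>t. prefix (sn n) t \<and> \<Phi> (kn n) t = Some (\<tau> n))"
      if "\<tau> \<in> finsupp P" for \<tau>
      unfolding Q4_def using tau[OF that] spe by (simp add: PC SPE)
    have Q5: "Q5 (hstr s) (hgsys \<Phi>) \<longleftrightarrow> (\<exists>h>length s0. \<forall>t. length t = h \<longrightarrow> (\<exists>T. \<Phi> K t = Some T \<and> s \<notin> T))" for s
      unfolding Q5_def using spe inP by (simp add: PC SPE image_iff) blast
    show ?thesis
      unfolding Q_def carries_witness_def by (auto simp: FS(2) Q1 Q2 Q3 Q4 Q5)
  qed
  then have "{x \<in> hgsys ` spg P. Q x} = hgsys ` {\<Phi> \<in> spg P. carries_witness P c F1 a F2 kn sn K s0 \<Phi>}"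
    by auto
  ultimately show ?thesis by simp
qed

end

section \<open>Limits of increasing sequences and generic trees\<close>

lemma increasing_stable:
  assumes inc: "increasing_seq P \<Phi>" and T: "\<Phi> j k s = Some T" and "j \<le> i"
  shows "\<Phi> i k s = Some T"
  using assms(3)
proof (induction i rule: dec_induct)
  case base
  show ?case by (rule T)
next
  case (step i)
  have "\<Phi> i k \<in> spe P" using inc unfolding increasing_seq_def spg_def by auto
  from spe_len[OF this step.IH] have "length s < ht (\<Phi> i k)" .
  moreover have "spe_le (\<Phi> i k) (\<Phi> (Suc i) k)"
    using inc unfolding increasing_seq_def spg_le_def by blast
  ultimately show ?case using step.IH unfolding spe_le_def by simp
qed

lemma lim_tree_eq:
  assumes inc: "increasing_seq P \<Phi>" and T: "\<Phi> j k s = Some T"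
  shows "lim_tree \<Phi> k s = T"
  unfolding lim_tree_def
proof (rule the_equality)
  fix T' assume "\<exists>i. \<Phi> i k s = Some T'"
  then obtain i where i: "\<Phi> i k s = Some T'" by (elim exE)
  have "\<Phi> (max i j) k s = Some T" by (rule increasing_stable[OF inc T]) simp
  moreover have "\<Phi> (max i j) k s = Some T'" by (rule increasing_stable[OF inc i]) simp
  ultimately show "T' = T" by simp
qed (use T in blast)

lemma spe_antimono:
  assumes "\<phi> \<in> spe P" "\<phi> (s @ r) = Some T'"
  shows "\<exists>T. \<phi> s = Some T \<and> T' \<subseteq> T"
  using assms(2)
proof (induction r arbitrary: T' rule: rev_induct)
  case (snoc i r)
  have "length (s @ r) < ht \<phi>" using spe_len[OF assms(1) snoc.prems] by simp
  then obtain T where T: "\<phi> (s @ r) = Some T" using spe_Some[OF assms(1)] by blast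
  then have "T' \<subseteq> T" using spe_step[OF assms(1) T, of i T'] snoc.prems by simp
  then show ?case using snoc.IH[OF T] by blast
qed auto

text \<open>At level \<open>length t\<close> the union in the intersection has the single index
  \<open>t\<close>.\<close>

lemma gen_tree_subset: "gen_tree \<Phi> k t \<subseteq> lim_tree \<Phi> k t"
proof
  fix x assume "x \<in> gen_tree \<Phi> k t"
  then have "x \<in> (\<Union>t'\<in>{t'. length t' = length t \<and> prefix t t'}. lim_tree \<Phi> k t')"
    unfolding gen_tree_def by blast
  then obtain t' where "length t' = length t" "prefix t t'" "x \<in> lim_tree \<Phi> k t'" by blast
  then show "x \<in> lim_tree \<Phi> k t" by (auto simp: prefix_def)
qed

text \<open>From level \<open>length t\<close> on, extensions of \<open>t\<close> are extensions of
  \<open>s\<close>. On lower levels a node of the tree at \<open>t\<close> lies in the larger tree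
  at the corresponding initial segment of \<open>t\<close>.\<close>

lemma gen_tree_antimono:
  assumes inc: "increasing_seq P \<Phi>" and st: "prefix s t" and T: "\<Phi> j k t = Some T"
  shows "gen_tree \<Phi> k t \<subseteq> gen_tree \<Phi> k s"
proof
  fix x assume x: "x \<in> gen_tree \<Phi> k t"
  have spe: "\<Phi> j k \<in> spe P" using inc unfolding increasing_seq_def spg_def by auto
  show "x \<in> gen_tree \<Phi> k s"
    unfolding gen_tree_def
  proof (rule INT_I)
    fix n assume "n \<in> {length s..}"
    then have n: "length s \<le> n" by simp
    show "x \<in> (\<Union>t\<in>{t. length t = n \<and> prefix s t}. lim_tree \<Phi> k t)"
    proof (cases "length t \<le> n")
      case True
      then have "x \<in> (\<Union>t'\<in>{t'. length t' = n \<and> prefix t t'}. lim_tree \<Phi> k t')"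
        using x unfolding gen_tree_def by blast
      then obtain t' where "length t' = n" "prefix t t'" "x \<in> lim_tree \<Phi> k t'" by blast
      moreover have "prefix s t'" using st \<open>prefix t t'\<close> by (rule prefix_order.trans)
      ultimately show ?thesis by blast
    next
      case False
      have "\<Phi> j k (take n t @ drop n t) = Some T" using T by simp
      from spe_antimono[OF spe this] obtain T' where T': "\<Phi> j k (take n t) = Some T'" "T \<subseteq> T'" by blast
      have "x \<in> T" using x gen_tree_subset[of \<Phi> k t] lim_tree_eq[OF inc T] by blast
      then have "x \<in> lim_tree \<Phi> k (take n t)" using lim_tree_eq[OF inc T'(1)] T'(2) by blast
      moreover have "prefix s (take n t)"
        using st n by (auto simp: prefix_def)
      moreover have "length (take n t) = n" using False by simp
      ultimately show ?thesis by blast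
    qed
  qed
qed

theorem theorem5p3:
  fixes M :: "hc set" and P :: "tree set" and \<Phi> :: "nat \<Rightarrow> gsys"
    and c :: real_sys and u :: cond and U :: tree
  assumes "ctm_ZFC' M"
    and "perfect_tree_forcing P" and "forcing_in P M"
    and "increasing_seq P \<Phi>" and "generic_over M P \<Phi>"
    and "real_name P c" and "real_sys_in c M"
    and "\<And>k. dense_in (finsupp P) {\<tau> \<in> finsupp P. forces_neq \<tau> c (pi_name k)}"
    and "u \<in> finsupp (P \<union> gen_trees \<Phi>)" and "U \<in> gen_trees \<Phi>"
  shows "\<exists>v \<in> finsupp (P \<union> gen_trees \<Phi>).
           (\<forall>n. v n \<noteq> UNIV \<longrightarrow> v n \<in> gen_trees \<Phi>) \<and> v \<le> u \<and>
           forces_notin_branches v c U"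
proof -
  note P = assms(2) and inc = assms(4) and c = assms(6)
  interpret ctm M by unfold_locales (rule assms(1))
  have PM: "set_in (htree ` P) M" using assms(3) by (simp add: forcing_in_def)
  have finu: "finite {n. u n \<noteq> UNIV}" using assms(9) by (simp add: finsupp_def)
  \<comment> \<open>A proper component that is both in \<open>P\<close> and generic is treated as a
    member of \<open>P\<close>.\<close>
  define F1 where "F1 = {n. u n \<noteq> UNIV \<and> u n \<in> P}"
  define F2 where "F2 = {n. u n \<noteq> UNIV \<and> u n \<notin> P}"
  have F: "finite F1" "finite F2" "F1 \<inter> F2 = {}"
    by (rule finite_subset[OF _ finu]; auto simp: F1_def F2_def)+ (auto simp: F1_def F2_def)
  have F1: "u n \<in> P" if "n \<in> F1" for n using that by (simp add: F1_def)
  have "\<exists>k s. u n = gen_tree \<Phi> k s" if "n \<in> F2" for n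
  proof -
    have "u n \<in> P \<union> gen_trees \<Phi>" using assms(9) by (auto simp: finsupp_def)
    then show ?thesis using that unfolding F2_def gen_trees_def by blast
  qed
  then obtain kn sn where kn: "\<And>n. n \<in> F2 \<Longrightarrow> u n = gen_tree \<Phi> (kn n) (sn n)" by metis
  obtain K s0 where U: "U = gen_tree \<Phi> K s0" using assms(10) unfolding gen_trees_def by blast
  let ?D = "{\<Psi> \<in> spg P. carries_witness P c F1 u F2 kn sn K s0 \<Psi>}"
  have "gsys_set_in ?D M"
    unfolding gsys_set_in_def by (rule set_in_carries_witness[OF P PM c assms(7) F(1,2) F1])
  moreover have "spg_dense P ?D"
    unfolding spg_dense_def
  proof (intro conjI ballI)
    fix \<Psi> assume "\<Psi> \<in> spg P"
    have "\<exists>\<Psi>'\<in>spg P. spg_le \<Psi> \<Psi>' \<and> carries_witness P c F1 u F2 kn sn K s0 \<Psi>'"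
      by (rule carries_witness_dense[OF P c assms(8) F _ \<open>\<Psi> \<in> spg P\<close>]) (rule F1)
    then show "\<exists>\<Psi>'\<in>?D. spg_le \<Psi> \<Psi>'" by blast
  qed auto
  ultimately obtain j where j: "\<Phi> j \<in> ?D" using assms(5) unfolding generic_over_def by blast
  then obtain \<tau> s h where \<tau>: "\<tau> \<in> finsupp P" "forces_initial \<tau> s c"
      "\<And>n. \<tau> n = UNIV \<or> (\<exists>k t. \<Phi> j k t = Some (\<tau> n))"
      "\<And>n. n \<in> F1 \<Longrightarrow> \<tau> n \<subseteq> u n"
      "\<And>n. n \<in> F2 \<Longrightarrow> \<exists>t. prefix (sn n) t \<and> \<Phi> j (kn n) t = Some (\<tau> n)"
      "length s0 < h" "\<And>t. length t = h \<Longrightarrow> \<exists>T. \<Phi> j K t = Some T \<and> s \<notin> T"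
    unfolding carries_witness_def by blast
  have gen: "gen_tree \<Phi> k t \<subseteq> T" if "\<Phi> j k t = Some T" for k t T
    using gen_tree_subset[of \<Phi> k t] lim_tree_eq[OF inc that] by simp
  \<comment> \<open>The last clause keeps the support of \<open>v\<close> finite: it is contained in
    the support of \<tau> together with \<open>F2\<close>.\<close>
  have "\<exists>V. (V = UNIV \<or> V \<in> gen_trees \<Phi>) \<and> V \<subseteq> \<tau> n \<and> V \<subseteq> u n \<and> (V \<noteq> UNIV \<longrightarrow> \<tau> n \<noteq> UNIV \<or> n \<in> F2)" for n
  proof (cases "n \<in> F2")
    case True
    from \<tau>(5)[OF this] obtain t where t: "prefix (sn n) t" "\<Phi> j (kn n) t = Some (\<tau> n)" by blast
    show ?thesis
      using gen[OF t(2)] gen_tree_antimono[OF inc t] kn[OF True] True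
      by (intro exI[of _ "gen_tree \<Phi> (kn n) t"]) (auto simp: gen_trees_def)
  next
    case F2: False
    show ?thesis
    proof (cases "\<tau> n = UNIV")
      case True
      \<comment> \<open>On \<open>F1\<close> a full \<open>\<tau> n\<close> would make
        \<open>u n\<close> full as well, so outside \<open>F2\<close> nothing proper is demanded
        here and \<open>UNIV\<close> can be taken.\<close>
      have "u n = UNIV"
      proof (cases "n \<in> F1")
        case True
        then show ?thesis using \<tau>(4)[OF True] \<open>\<tau> n = UNIV\<close> by auto
      qed (use F2 in \<open>auto simp: F1_def F2_def\<close>)
      then show ?thesis using True by (intro exI[of _ UNIV]) auto
    next
      case False
      with \<tau>(3)[of n] obtain k t where t: "\<Phi> j k t = Some (\<tau> n)" by blast
      have "\<tau> n \<subseteq> u n" using F2 \<tau>(4)[of n] by (cases "n \<in> F1") (auto simp: F1_def F2_def)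
      then show ?thesis using gen[OF t] False
        by (intro exI[of _ "gen_tree \<Phi> k t"]) (auto simp: gen_trees_def)
    qed
  qed
  then obtain v where v: "\<And>n. v n = UNIV \<or> v n \<in> gen_trees \<Phi>" "\<And>n. v n \<subseteq> \<tau> n" "\<And>n. v n \<subseteq> u n"
    "\<And>n. v n \<noteq> UNIV \<Longrightarrow> \<tau> n \<noteq> UNIV \<or> n \<in> F2" by metis
  have "UNIV \<in> P" using P by (simp add: perfect_tree_forcing_def)
  then have "v n \<in> P \<union> gen_trees \<Phi>" for n using v(1)[of n] by auto
  moreover have "finite {n. v n \<noteq> UNIV}"
  proof (rule finite_subset)
    show "{n. v n \<noteq> UNIV} \<subseteq> {n. \<tau> n \<noteq> UNIV} \<union> F2" using v(4) by blast
    show "finite ({n. \<tau> n \<noteq> UNIV} \<union> F2)" using \<tau>(1) F by (simp add: finsupp_def)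
  qed
  ultimately have "v \<in> finsupp (P \<union> gen_trees \<Phi>)"
    by (auto simp: finsupp_def)
  moreover have "v \<le> u" "v \<le> \<tau>" using v(2,3) by (simp_all add: le_fun_def)
  moreover have "forces_notin_branches v c U"
    unfolding forces_notin_branches_def
  proof (intro exI conjI)
    show "forces_initial v s c" by (rule forces_initial_mono[OF \<tau>(2) \<open>v \<le> \<tau>\<close>])
    show "s \<notin> U"
    proof
      assume "s \<in> U"
      \<comment> \<open>Level \<open>h\<close> takes part in the intersection defining
        \<open>U\<close> because \<open>h\<close> exceeds the length of \<open>s0\<close>.\<close>
      then have "s \<in> (\<Union>t\<in>{t. length t = h \<and> prefix s0 t}. lim_tree \<Phi> K t)"
        using \<tau>(6) unfolding U gen_tree_def by fastforce
      then obtain t where t: "length t = h" "s \<in> lim_tree \<Phi> K t" by blast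
      from \<tau>(7)[OF t(1)] obtain T where "\<Phi> j K t = Some T" "s \<notin> T" by blast
      then show False using lim_tree_eq[OF inc, of j K t T] t(2) by simp
    qed
  qed
  ultimately show ?thesis using v(1) by blast
qed

end
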